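(* Let $(A,B,C,D)$ be reduced words in $a^{\pm1},b^{\pm1}$. Then $(A,B,C,D)$ defines a local $\mathrm{Aut}(F_3)$ braid representation if and only if, up to natural symmetries, $(A,B,C,D)$ is one of the following: ($T$) $(a,b,a,b)$; ($T'$) $(a,b^{-1},a^{-1},b)$; ($A_r$-1) $(a^{r}ba^{-r},\,a,\,a^{r}ba^{-r},\,a)$, $r\in\mathbb{Z}_{\ge0}$; ($A_r$-2) $(a^{r}ba^{-r},\,a,\,a^{r}b^{-1}a^{-r},\,a^{-1})$, $r\in\mathbb{Z}_{\ge0}$; ($A_r$-3) $(a^{r}b^{-1}a^{-r},\,a^{-1},\,a^{-r}b^{-1}a^{r},\,a^{-1})$, $r\in\mathbb{Z}_{\ge0}$; ($B$-1) $(b^{-1},a,b^{-1},a)$; ($B$-2) $(b^{-1},a,b,a^{-1})$; ($C$-1) $(ab^{-1}a,\,a,\,ab^{-1}a,\,a)$; ($C$-2) $(ab^{-1}a,\,a,\,aba,\,a^{-1})$; ($C$-3) $(aba,\,a^{-1},\,aba,\,a^{-1})$; ($D$-1) $(a^{-1}b^{-1}a,\,b^{2}a,\,a^{-1}b^{-1}a,\,b^{2}a)$; ($D$-2) $(aba^{-1},\,b^{2}a^{-1},\,a^{-1}b^{-1}a,\,b^{2}a)$; ($D$-3) $(a^{-1}b^{-1}a,\,b^{2}a,\,a^{-1}ba,\,a^{-1}b^{2})$; ($D$-4) $(aba^{-1},\,b^{2}a^{-1},\,a^{-1}ba,\,a^{-1}b^{2})$.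
   Context: $F_2$ is the free group on $a,b$; $F_3$ is the free group on $x_1,x_2,x_3$; $B_3$ is the 3-strand braid group with standard generators $\sigma_1,\sigma_2$ (acting on the right). For a word $W$ in $a^{\pm1},b^{\pm1}$ and elements $U,V$ of a group, $W(U,V)$ denotes the result of substituting $U$ for $a$ and $V$ for $b$. A quadruple $(A,B,C,D)$ of reduced words in $a^{\pm1},b^{\pm1}$ defines a local $\mathrm{Aut}(F_3)$ braid representation if the endomorphisms $\tau:a\mapsto A,\ b\mapsto B$ and $\kappa: a\mapsto C,\ b\mapsto D$ of $F_2$ are automorphisms and the automorphisms $s_1,s_2$ of $F_3$ given by $s_1: x_1\mapsto A(x_1,x_2),\ x_2\mapsto B(x_1,x_2),\ x_3\mapsto x_3$ and $s_2: x_1\mapsto x_1,\ x_2\mapsto C(x_2,x_3),\ x_3\mapsto D(x_2,x_3)$ satisfy $s_1s_2s_1=s_2s_1s_2$, so that $\sigma_1\mapsto s_1$, $\sigma_2\mapsto s_2$ defines an action of $B_3$ on $F_3$. Natural symmetries act on such quadruples as follows. Inverse: replace $(A,B,C,D)$ by the reduced words representing $\tau^{-1}(a),\tau^{-1}(b),\kappa^{-1}(a),\kappa^{-1}(b)$. Swap: replace $(A,B,C,D)$ by $(D^{\sigma},C^{\sigma},B^{\sigma},A^{\sigma})$, where $W^{\sigma}$ is obtained from $W$ by interchanging the letters $a$ and $b$ (e.g. $(a^{-2}ba)^{\sigma}=b^{-2}ab$). Backward: replace $(A,B,C,D)$ by $(\overleftarrow{A},\overleftarrow{B},\overleftarrow{C},\overleftarrow{D})$,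 where $\overleftarrow{W}$ is $W$ read backwards (e.g. $\overleftarrow{b^{-1}aba^{2}}=a^{2}bab^{-1}$). "Up to natural symmetries" means: obtained from a listed quadruple by a composition of these operations. *)

theory Defs
  imports Main
begin

text \<open>A letter is a pair (e, g): (False, g) stands for the generator g,
  (True, g) for its inverse. An element of the free group on the generators
  of type 'g is represented by a freely reduced word.\<close>

type_synonym 'g fword = "(bool \<times> 'g) list"

datatype gen2 = Ga | Gb
datatype gen3 = X1 | X2 | X3

definition inv_letter :: "bool \<times> 'g \<Rightarrow> bool \<times> 'g" where
  "inv_letter l = (\<not> fst l, snd l)"

fun reduced :: "'g fword \<Rightarrow> bool" where
  "reduced [] = True"
| "reduced [x] = True"
| "reduced (x # y # r) = (y \<noteq> inv_letter x \<and> reduced (y # r))"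

definition red :: "'g fword \<Rightarrow> 'g fword" where
  "red w = foldr (\<lambda>l acc. case acc of [] \<Rightarrow> [l]
                   | m # r \<Rightarrow> (if m = inv_letter l then r else l # m # r)) w []"

definition inv_word :: "'g fword \<Rightarrow> 'g fword" where
  "inv_word w = rev (map inv_letter w)"

definition subst :: "('g \<Rightarrow> 'h fword) \<Rightarrow> 'g fword \<Rightarrow> 'h fword" where
  "subst f w = red (concat (map (\<lambda>l. if fst l then inv_word (f (snd l)) else f (snd l)) w))"

definition is_aut :: "('g \<Rightarrow> 'g fword) \<Rightarrow> bool" where
  "is_aut f \<longleftrightarrow> bij_betw (subst f) {w. reduced w} {w. reduced w}"

definition comp_end :: "('g \<Rightarrow> 'g fword) \<Rightarrow> ('g \<Rightarrow> 'g fword) \<Rightarrow> 'g \<Rightarrow> 'g fword" where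
  "comp_end f g = (\<lambda>x. subst f (g x))"

type_synonym quad = "gen2 fword \<times> gen2 fword \<times> gen2 fword \<times> gen2 fword"

definition pair_end :: "gen2 fword \<Rightarrow> gen2 fword \<Rightarrow> gen2 \<Rightarrow> gen2 fword" where
  "pair_end U V = (\<lambda>g. case g of Ga \<Rightarrow> U | Gb \<Rightarrow> V)"

definition evalW :: "gen2 fword \<Rightarrow> 'h fword \<Rightarrow> 'h fword \<Rightarrow> 'h fword" where
  "evalW W U V = subst (\<lambda>g. case g of Ga \<Rightarrow> U | Gb \<Rightarrow> V) W"

definition x :: "gen3 \<Rightarrow> gen3 fword" where "x g = [(False, g)]"

definition s1_of :: "quad \<Rightarrow> gen3 \<Rightarrow> gen3 fword" where
  "s1_of q = (case q of (A, B, C, D) \<Rightarrow>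
     (\<lambda>g. case g of X1 \<Rightarrow> evalW A (x X1) (x X2) | X2 \<Rightarrow> evalW B (x X1) (x X2) | X3 \<Rightarrow> x X3))"

definition s2_of :: "quad \<Rightarrow> gen3 \<Rightarrow> gen3 fword" where
  "s2_of q = (case q of (A, B, C, D) \<Rightarrow>
     (\<lambda>g. case g of X1 \<Rightarrow> x X1 | X2 \<Rightarrow> evalW C (x X2) (x X3) | X3 \<Rightarrow> evalW D (x X2) (x X3)))"

definition local_braid_rep :: "quad \<Rightarrow> bool" where
  "local_braid_rep q = (case q of (A, B, C, D) \<Rightarrow>
     is_aut (pair_end A B) \<and> is_aut (pair_end C D) \<and>
     comp_end (s1_of q) (comp_end (s2_of q) (s1_of q))
       = comp_end (s2_of q) (comp_end (s1_of q) (s2_of q)))"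

definition swap_letter :: "bool \<times> gen2 \<Rightarrow> bool \<times> gen2" where
  "swap_letter l = (fst l, case snd l of Ga \<Rightarrow> Gb | Gb \<Rightarrow> Ga)"

definition sym_swap :: "quad \<Rightarrow> quad" where
  "sym_swap q = (case q of (A, B, C, D) \<Rightarrow>
     (map swap_letter D, map swap_letter C, map swap_letter B, map swap_letter A))"

definition sym_backward :: "quad \<Rightarrow> quad" where
  "sym_backward q = (case q of (A, B, C, D) \<Rightarrow> (rev A, rev B, rev C, rev D))"

definition aut_inv_img :: "(gen2 \<Rightarrow> gen2 fword) \<Rightarrow> gen2 \<Rightarrow> gen2 fword" where
  "aut_inv_img f g = inv_into {w. reduced w} (subst f) [(False, g)]"

definition sym_inverse :: "quad \<Rightarrow> quad" where
  "sym_inverse q = (case q of (A, B, C, D) \<Rightarrow>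
     (aut_inv_img (pair_end A B) Ga, aut_inv_img (pair_end A B) Gb,
      aut_inv_img (pair_end C D) Ga, aut_inv_img (pair_end C D) Gb))"

abbreviation la :: "bool \<times> gen2" where "la \<equiv> (False, Ga)"
abbreviation lA :: "bool \<times> gen2" where "lA \<equiv> (True, Ga)"
abbreviation lb :: "bool \<times> gen2" where "lb \<equiv> (False, Gb)"
abbreviation lB :: "bool \<times> gen2" where "lB \<equiv> (True, Gb)"

definition listed :: "quad \<Rightarrow> bool" where
  "listed q \<longleftrightarrow>
     q = ([la], [lb], [la], [lb])
   \<or> q = ([la], [lB], [lA], [lb])
   \<or> (\<exists>r::nat. q = (replicate r la @ [lb] @ replicate r lA, [la],
                     replicate r la @ [lb] @ replicate r lA, [la]))
   \<or> (\<exists>r::nat. q = (replicate r la @ [lb] @ replicate r lA, [la],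
                     replicate r la @ [lB] @ replicate r lA, [lA]))
   \<or> (\<exists>r::nat. q = (replicate r la @ [lB] @ replicate r lA, [lA],
                     replicate r lA @ [lB] @ replicate r la, [lA]))
   \<or> q = ([lB], [la], [lB], [la])
   \<or> q = ([lB], [la], [lb], [lA])
   \<or> q = ([la, lB, la], [la], [la, lB, la], [la])
   \<or> q = ([la, lB, la], [la], [la, lb, la], [lA])
   \<or> q = ([la, lb, la], [lA], [la, lb, la], [lA])
   \<or> q = ([lA, lB, la], [lb, lb, la], [lA, lB, la], [lb, lb, la])
   \<or> q = ([la, lb, lA], [lb, lb, lA], [lA, lB, la], [lb, lb, la])
   \<or> q = ([lA, lB, la], [lb, lb, la], [lA, lb, la], [lA, lb, lb])
   \<or> q = ([la, lb, lA], [lb, lb, lA], [lA, lb, la], [lA, lb, lb])"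

text \<open>Quadruples obtained from a listed one by compositions of the natural
  symmetries. The inverse operation is only applied when both endomorphisms
  are automorphisms (where it is defined).\<close>
inductive up_to_symmetry :: "quad \<Rightarrow> bool" where
  base: "listed q \<Longrightarrow> up_to_symmetry q"
| swap: "up_to_symmetry q \<Longrightarrow> up_to_symmetry (sym_swap q)"
| backward: "up_to_symmetry q \<Longrightarrow> up_to_symmetry (sym_backward q)"
| inverse: "up_to_symmetry (A, B, C, D) \<Longrightarrow> is_aut (pair_end A B) \<Longrightarrow> is_aut (pair_end C D)
             \<Longrightarrow> up_to_symmetry (sym_inverse (A, B, C, D))"

end

theory Submission
  imports Defs
begin

text \<open>
The relation \<open>s\<^sub>1s\<^sub>2s\<^sub>1 = s\<^sub>2s\<^sub>1s\<^sub>2\<close> amounts to three equations between elements of the free group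
of rank three, which may be evaluated in every group. In the integers they leave only finitely many
exponent matrices of \<open>(A, B)\<close> and \<open>(C, D)\<close>. By Nielsen's theorem that an automorphism of the free group
of rank two acting trivially on the abelianization is inner, \<open>(A, B)\<close> and \<open>(C, D)\<close> are then
simultaneous conjugates of explicit pairs, and the unknowns are the conjugators. Evaluating the
equations at tuples with some entries trivial or repeated turns them into equations for the
conjugators which are decided by two facts: a pair of elements of a free group either commutes or
generates a free group of rank two, and commuting elements with the same nonzero exponents are equal.
\<close>

text \<open>Two obstacles shape the argument. Inverting only some of x1, x2, x3 preserves the braid
  relation but is not a natural symmetry. Outside the diagonal case the equations are solved after
  inverting x1 and x3 as needed, so that b has exponent 1 in A and C; afterwards every sign pattern
  has to be matched with the list, and patterns missing there are recovered by inverse, swap or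
  backward. Moreover the integers admit matrices that lead to no solution, with rows (-2, q) and (r,
  2) where qr = -3; excluding them takes a nonabelian argument about fixed points of an involution.

  An equation between two conjugates of a generator determines the conjugators only up to a power of
  that generator. Setting the generator to 1 afterwards removes the unknown power, and exponent sums
  or commutation decide the rest.\<close>

hide_const (open) Defs.x

section \<open>Groups in multiplicative notation\<close>

text \<open>Commutativity is not assumed. Building on \<open>monoid_mult\<close> and
  \<open>inverse\<close> makes \<open>^\<close> and \<open>powi\<close> apply to free groups and to
  the Heisenberg group alike.\<close>

class group_mult = monoid_mult + inverse +
  assumes left_inverse_mult [simp]: "inverse a * a = 1"
    and divide_eq_mult_inverse: "divide a b = a * inverse b"
begin

lemma left_inverse_mult_left [simp]: "inverse a * (a * b) = b"
  by (simp flip: mult.assoc)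

lemma group_mult_left_cancel [simp]: "a * b = a * c \<longleftrightarrow> b = c"
  by (metis left_inverse_mult_left)

lemma right_inverse_mult [simp]: "a * inverse a = 1"
proof -
  have "inverse a * (a * inverse a) = inverse a * 1" by simp
  then show ?thesis by (simp only: group_mult_left_cancel)
qed

lemma right_inverse_mult_left [simp]: "a * (inverse a * b) = b"
  by (simp flip: mult.assoc)

lemma group_mult_right_cancel [simp]: "b * a = c * a \<longleftrightarrow> b = c"
proof
  assume "b * a = c * a"
  then have "b * a * inverse a = c * a * inverse a" by simp
  then show "b = c" by (simp add: mult.assoc)
qed simp

lemma inverse_eqI: "a * b = 1 \<Longrightarrow> inverse a = b"
  by (metis left_inverse_mult_left mult_1_right)

lemma group_inverse_mult [simp]: "inverse (a * b) = inverse b * inverse a"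
  by (rule inverse_eqI) (simp add: mult.assoc)

lemma group_inverse_inverse [simp]: "inverse (inverse a) = a"
  by (rule inverse_eqI) simp

lemma group_inverse_one [simp]: "inverse 1 = 1"
  by (rule inverse_eqI) simp

lemma group_inverse_eq_one_iff [simp]: "inverse a = 1 \<longleftrightarrow> a = 1"
  by (metis group_inverse_inverse group_inverse_one)

lemma mult_inverse_eq_one_iff: "a * inverse b = 1 \<longleftrightarrow> a = b"
  by (metis group_mult_right_cancel right_inverse_mult)

lemma group_eq_mult_inverse_iff: "a = b * inverse c \<longleftrightarrow> a * c = b"
  by (metis group_mult_right_cancel left_inverse_mult mult.assoc mult_1_right)

lemma commute_inverse: "a * b = b * a \<Longrightarrow> inverse a * b = b * inverse a"
  by (metis left_inverse_mult_left mult.assoc group_eq_mult_inverse_iff)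

end

section \<open>Integer powers in noncommutative groups\<close>

lemma power_inverse_group: "inverse (a::'a::group_mult) ^ n = inverse (a ^ n)"
  by (induction n) (simp_all flip: power_commutes)

lemma power_int_of_nat: "(a::'a::group_mult) powi int n = a ^ n"
  by (simp add: power_int_def)

lemma power_int_neg_of_nat: "(a::'a::group_mult) powi (- int n) = inverse (a ^ n)"
  by (simp add: power_int_def power_inverse_group)

lemma power_int_one_group [simp]: "(1::'a::group_mult) powi i = 1"
  by (simp add: power_int_def)

lemma power_int_add_one_group: "(a::'a::group_mult) powi (i + 1) = a * a powi i"
proof (cases i rule: int_cases2)
  case (nonneg n)
  then have "a powi (i + 1) = a powi int (Suc n)" by (simp add: algebra_simps)
  then show ?thesis unfolding power_int_of_nat using nonneg by (simp add: power_int_of_nat)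
next
  case (nonpos n)
  show ?thesis
  proof (cases n)
    case (Suc k)
    then have "a powi (i + 1) = a powi (- int k)" using nonpos by simp
    then show ?thesis
      unfolding power_int_neg_of_nat nonpos(1) Suc power_Suc2
      by (simp add: mult.assoc)
  qed (use nonpos in simp)
qed

lemma power_int_add_group: "(a::'a::group_mult) powi (i + j) = a powi i * a powi j"
proof (induction i rule: int_induct[where k = 0])
  case (step1 i)
  have "a powi (i + 1 + j) = a powi ((i + j) + 1)" by (simp add: algebra_simps)
  then show ?case by (simp add: power_int_add_one_group step1 mult.assoc)
next
  case (step2 i)
  have "a * a powi (i - 1 + j) = a powi ((i - 1 + j) + 1)"
    by (simp only: power_int_add_one_group)
  also have "\<dots> = a powi ((i - 1) + 1) * a powi j" using step2 by simp
  also have "\<dots> = a * (a powi (i - 1) * a powi j)"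
    by (simp only: power_int_add_one_group mult.assoc)
  finally show ?case by simp
qed simp

lemma power_int_minus_group: "(a::'a::group_mult) powi (- i) = inverse (a powi i)"
  by (rule inverse_eqI[symmetric]) (simp flip: power_int_add_group)

lemma power_int_mult_group: "(a::'a::group_mult) powi (i * j) = (a powi i) powi j"
proof (induction j rule: int_induct[where k = 0])
  case (step1 j)
  then show ?case by (simp add: distrib_left power_int_add_group)
next
  case (step2 j)
  have "a powi (i * j) = a powi (i * (j - 1)) * a powi i"
    by (simp add: algebra_simps flip: power_int_add_group)
  moreover have "(a powi i) powi j = (a powi i) powi (j - 1) * a powi i"
    using power_int_add_group[of "a powi i" "j - 1" 1] by simp
  ultimately show ?case using step2 by simp
qed simp

lemma power_int_commute_group:
  "(a::'a::group_mult) powi i * a powi j = a powi j * a powi i"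
  by (simp add: add.commute flip: power_int_add_group)

lemma commute_power_int:
  assumes "(a::'a::group_mult) * b = b * a"
  shows "a powi i * b = b * a powi i"
proof (induction i rule: int_induct[where k = 0])
  case (step1 i)
  then show ?case using assms by (metis power_int_add_one_group mult.assoc)
next
  case (step2 i)
  have "a powi (i - 1) = inverse a * a powi i"
    using power_int_add_one_group[of a "i - 1"] by simp
  then show ?case using step2 commute_inverse[OF assms] by (metis mult.assoc)
qed simp

lemma power_int_conj:
  "((h::'a::group_mult) * w * inverse h) powi i = h * w powi i * inverse h"
proof (induction i rule: int_induct[where k = 0])
  case (step1 i)
  then show ?case by (simp only: power_int_add_one_group mult.assoc left_inverse_mult_left)
next
  case (step2 i)
  have *: "a powi (i - 1) = inverse a * a powi i" for a :: 'a
    using power_int_add_one_group[of a "i - 1"] by simp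
  show ?case unfolding * step2 by (simp add: mult.assoc)
qed simp

lemma power_int_inverse_group: "inverse (u::'a::group_mult) powi i = inverse (u powi i)"
  by (simp add: power_int_def power_inverse_group)

lemma power_int_conj_self [simp]: "(u::'a::group_mult) powi m * (u * inverse (u powi m)) = u"
  using power_int_commute_group[of u m 1] by (simp flip: mult.assoc) (simp add: mult.assoc)

section \<open>Free groups\<close>

lemma inv_letter_simps [simp]:
  "inv_letter (inv_letter l) = l" "fst (inv_letter l) = (\<not> fst l)" "snd (inv_letter l) = snd l"
  "inv_letter l \<noteq> l" "l \<noteq> inv_letter l" "inv_letter l = inv_letter m \<longleftrightarrow> l = m"
  by (auto simp: inv_letter_def prod_eq_iff)

lemma inv_letter_Pair [simp]: "inv_letter (e, g) = (\<not> e, g)"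
  by (simp add: inv_letter_def)

lemma reduced_iff_successively: "reduced w \<longleftrightarrow> successively (\<lambda>l m. m \<noteq> inv_letter l) w"
  by (induction w rule: reduced.induct) auto

lemma reduced_Cons: "reduced (l # w) \<longleftrightarrow> w = [] \<or> hd w \<noteq> inv_letter l \<and> reduced w"
  by (simp add: reduced_iff_successively successively_Cons)

lemma reduced_append:
  "reduced (u @ v) \<longleftrightarrow>
     reduced u \<and> reduced v \<and> (u = [] \<or> v = [] \<or> hd v \<noteq> inv_letter (last u))"
  by (simp add: reduced_iff_successively successively_append_iff)

lemma inv_word_simps [simp]:
  "inv_word [] = []" "inv_word (u @ v) = inv_word v @ inv_word u"
  "inv_word (l # u) = inv_word u @ [inv_letter l]"
  "inv_word (inv_word u) = u" "length (inv_word u) = length u" "inv_word u = [] \<longleftrightarrow> u = []"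
  by (auto simp: inv_word_def rev_map o_def)

lemma reduced_inv_word [simp]: "reduced (inv_word w) \<longleftrightarrow> reduced w"
proof -
  have "successively (\<lambda>l m. l \<noteq> inv_letter m) w = successively (\<lambda>l m. m \<noteq> inv_letter l) w"
    by (rule successively_cong) auto
  then show ?thesis
    by (simp add: reduced_iff_successively inv_word_def successively_map)
qed

definition push :: "bool \<times> 'g \<Rightarrow> 'g fword \<Rightarrow> 'g fword" where
  "push l w = (case w of [] \<Rightarrow> [l] | m # r \<Rightarrow> if m = inv_letter l then r else l # m # r)"

lemma push_simps [simp]:
  "push l [] = [l]" "push l (m # r) = (if m = inv_letter l then r else l # m # r)"
  by (simp_all add: push_def)

lemma red_conv_push: "red w = foldr push w []"
  unfolding red_def push_def ..

lemma red_simps [simp]: "red [] = []" "red (l # w) = push l (red w)"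
  by (simp_all add: red_conv_push)

lemma reduced_push: "reduced w \<Longrightarrow> reduced (push l w)"
  by (cases w) (auto simp: reduced_Cons)

lemma reduced_red [simp]: "reduced (red w)"
  by (induction w) (auto intro: reduced_push)

lemma push_push_inv: "reduced w \<Longrightarrow> push l (push (inv_letter l) w) = w"
  by (cases w; cases "tl w") (auto simp: reduced_Cons)

lemma red_reduced [simp]: "reduced w \<Longrightarrow> red w = w"
  by (induction w rule: reduced.induct) auto

text \<open>Van der Waerden's argument: letters act on reduced words by \<open>push\<close>, and
  inverse letters act by inverse permutations. So a cancellation does not change the action of a
  word, which later yields associativity of the product.\<close>

lemma foldr_push_push:
  assumes "reduced acc"
  shows "foldr push (push l r) acc = push l (foldr push r acc)"
proof -
  have "reduced (foldr push r acc)" for r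
    by (induction r) (auto simp: assms intro: reduced_push)
  then show ?thesis by (cases r) (auto simp: push_push_inv)
qed

lemma foldr_push_red: "reduced acc \<Longrightarrow> foldr push (red u) acc = foldr push u acc"
  by (induction u) (simp_all add: foldr_push_push)

lemma red_append_red: "red (red u @ red v) = red (u @ v)"
proof -
  have "red (red u @ red v) = foldr push (red u) (red (red v))" by (simp add: red_conv_push)
  also have "\<dots> = foldr push u (red v)" by (simp add: foldr_push_red)
  also have "\<dots> = red (u @ v)" by (simp add: red_conv_push)
  finally show ?thesis .
qed

lemma red_append_red_left: "red (red u @ v) = red (u @ v)"
  and red_append_red_right: "red (u @ red v) = red (u @ v)"
  by (metis red_append_red red_reduced reduced_red)+

lemma red_inv_word_append: "red (inv_word w @ w) = []"
proof (induction w)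
  case (Cons l w)
  have "red (inv_word (l # w) @ l # w) = red (inv_word w @ red (inv_letter l # l # w))"
    by (simp add: red_append_red_right del: red_simps)
  also have "red (inv_letter l # l # w) = red w"
    using push_push_inv[of "red w" "inv_letter l"] by simp
  finally show ?case using Cons by (simp add: red_append_red_right)
qed simp

section \<open>The free group as a group of reduced words, and its universal property\<close>

typedef 'g free = "{w :: 'g fword. reduced w}"
  morphisms word_of Free
  by (rule exI[of _ "[]"]) simp

setup_lifting type_definition_free

instantiation free :: (type) group_mult
begin

lift_definition one_free :: "'a free" is "[]" by simp
lift_definition times_free :: "'a free \<Rightarrow> 'a free \<Rightarrow> 'a free" is "\<lambda>u v. red (u @ v)" by simp
lift_definition inverse_free :: "'a free \<Rightarrow> 'a free" is inv_word by simp
definition divide_free :: "'a free \<Rightarrow> 'a free \<Rightarrow> 'a free" where "divide_free u v = u * inverse v"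

instance
proof
  fix a b c :: "'a free"
  show "a * b * c = a * (b * c)"
    by transfer (simp add: red_append_red_left red_append_red_right)
  show "1 * a = a" by transfer simp
  show "a * 1 = a" by transfer simp
  show "inverse a * a = 1" by transfer (rule red_inv_word_append)
  show "divide a b = a * inverse b" by (rule divide_free_def)
qed

end

lift_definition free_of :: "'g fword \<Rightarrow> 'g free" is red by simp

lemma word_of_simps [simp]:
  "reduced (word_of u)" "word_of 1 = []" "word_of (inverse u) = inv_word (word_of u)"
  by (transfer; simp)+

lemma word_of_mult: "word_of (u * v) = red (word_of u @ word_of v)"
  by transfer simp

lemma word_of_inject' [simp]: "word_of u = word_of v \<longleftrightarrow> u = v"
  by (rule word_of_inject)

lemma word_of_eq_Nil_iff [simp]: "word_of u = [] \<longleftrightarrow> u = 1"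
  by transfer simp

lemma word_of_free_of [simp]: "word_of (free_of w) = red w"
  by transfer simp

lemma free_of_word_of [simp]: "free_of (word_of u) = u"
  by transfer simp

lemma free_of_append: "free_of (u @ v) = free_of u * free_of v"
  by transfer (simp add: red_append_red)

lemma free_of_Nil [simp]: "free_of [] = 1"
  by transfer simp

lemma free_of_inv_word: "free_of (inv_word w) = inverse (free_of w)"
proof -
  have "free_of (inv_word w) * free_of w = 1"
    unfolding free_of_append[symmetric] by transfer (rule red_inv_word_append)
  then show ?thesis by (metis group_inverse_inverse inverse_eqI)
qed

lemma free_of_inject_reduced: "reduced u \<Longrightarrow> reduced v \<Longrightarrow> free_of u = free_of v \<Longrightarrow> u = v"
  by (metis red_reduced word_of_free_of)

definition gen :: "'g \<Rightarrow> 'g free" where "gen g = free_of [(False, g)]"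

lemma word_of_gen [simp]: "word_of (gen g) = [(False, g)]"
  by (simp add: gen_def)

definition letter_val :: "('g \<Rightarrow> 'h::group_mult) \<Rightarrow> bool \<times> 'g \<Rightarrow> 'h" where
  "letter_val f l = (if fst l then inverse (f (snd l)) else f (snd l))"

definition word_val :: "('g \<Rightarrow> 'h::group_mult) \<Rightarrow> 'g fword \<Rightarrow> 'h" where
  "word_val f w = prod_list (map (letter_val f) w)"

lemma letter_val_simps [simp]:
  "letter_val f (inv_letter l) = inverse (letter_val f l)"
  "letter_val f (False, g) = f g" "letter_val f (True, g) = inverse (f g)"
  by (auto simp: letter_val_def)

lemma word_val_simps [simp]:
  "word_val f [] = 1" "word_val f (l # w) = letter_val f l * word_val f w"
  "word_val f (u @ v) = word_val f u * word_val f v"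
  by (simp_all add: word_val_def)

lemma word_val_push: "word_val f (push l w) = letter_val f l * word_val f w"
  by (cases w) auto

lemma word_val_red [simp]: "word_val f (red w) = word_val f w"
  by (induction w) (simp_all add: word_val_push)

lemma word_val_inv_word: "word_val f (inv_word w) = inverse (word_val f w)"
  by (induction w) simp_all

lemma free_of_Cons: "free_of (l # w) = letter_val gen l * free_of w"
proof -
  have "free_of [l] = letter_val gen l"
    using free_of_inv_word[of "[(False, snd l)]"]
    by (cases l) (auto simp: letter_val_def gen_def)
  then show ?thesis using free_of_append[of "[l]" w] by simp
qed

definition hom_ext :: "('g \<Rightarrow> 'h::group_mult) \<Rightarrow> 'g free \<Rightarrow> 'h" where
  "hom_ext f u = word_val f (word_of u)"

lemma hom_ext_simps [simp]:
  "hom_ext f 1 = 1" "hom_ext f (u * v) = hom_ext f u * hom_ext f v"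
  "hom_ext f (inverse u) = inverse (hom_ext f u)" "hom_ext f (gen g) = f g"
  by (simp_all add: hom_ext_def word_of_mult word_val_inv_word)

lemma hom_ext_free_of: "hom_ext f (free_of w) = word_val f w"
  by (simp add: hom_ext_def)

lemma hom_ext_power_int [simp]: "hom_ext f (u powi i) = hom_ext f u powi i"
proof -
  have "hom_ext f (u ^ n) = hom_ext f u ^ n" for u n by (induction n) auto
  then show ?thesis by (simp add: power_int_def)
qed

lemma free_induct [case_names one gen inv]:
  assumes "P 1" and "\<And>g u. P u \<Longrightarrow> P (gen g * u)" and "\<And>g u. P u \<Longrightarrow> P (inverse (gen g) * u)"
  shows "P u"
proof -
  have "P (free_of w)" for w
    by (induction w) (auto simp: free_of_Cons letter_val_def intro: assms)
  from this[of "word_of u"] show ?thesis by simp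
qed

section \<open>Words in two letters\<close>

abbreviation ga :: "gen2 free" where "ga \<equiv> gen Ga"
abbreviation gb :: "gen2 free" where "gb \<equiv> gen Gb"

definition ev :: "gen2 free \<Rightarrow> 'h::group_mult \<Rightarrow> 'h \<Rightarrow> 'h" where
  "ev W U V = hom_ext (case_gen2 U V) W"

lemma ev_simps [simp]:
  "ev 1 U V = 1" "ev (W * W') U V = ev W U V * ev W' U V"
  "ev (inverse W) U V = inverse (ev W U V)" "ev (W powi i) U V = ev W U V powi i"
  "ev ga U V = U" "ev gb U V = V"
  by (simp_all add: ev_def)

lemma ev_power [simp]: "ev (W ^ n) U V = ev W U V ^ n"
  by (induction n) simp_all

lemma free2_induct [case_names one a b inv_a inv_b]:
  assumes "P 1" "\<And>u. P u \<Longrightarrow> P (ga * u)" "\<And>u. P u \<Longrightarrow> P (gb * u)"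
    "\<And>u. P u \<Longrightarrow> P (inverse ga * u)" "\<And>u. P u \<Longrightarrow> P (inverse gb * u)"
  shows "P u"
proof (induction u rule: free_induct)
  case (gen g u)
  then show ?case by (cases g) (auto intro: assms)
next
  case (inv g u)
  then show ?case by (cases g) (auto intro: assms)
qed (rule assms)

lemma ev_ga_gb [simp]: "ev W ga gb = W"
  by (induction W rule: free2_induct) simp_all

lemma ev_ev: "ev (ev W U V) X Y = ev W (ev U X Y) (ev V X Y)"
  by (induction W rule: free2_induct) simp_all

lemma hom_ext_ev: "hom_ext f (ev W U V) = ev W (hom_ext f U) (hom_ext f V)"
  by (induction W rule: free2_induct) simp_all

lemma ev_conj: "ev W (h * U * inverse h) (h * V * inverse h) = h * ev W U V * inverse h"
  by (induction W rule: free2_induct) (simp_all add: mult.assoc)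

text \<open>The integral Heisenberg group in a symmetric form: the last coordinate carries twice the
  usual central coordinate of the logarithm, so that by the Baker--Campbell--Hausdorff formula
  evaluating a word is linear up to one commutator term.\<close>

datatype heis = Heis (ha: int) (hb: int) (hc: int)

instantiation heis :: group_mult
begin

definition one_heis :: heis where "one_heis = Heis 0 0 0"
definition times_heis :: "heis \<Rightarrow> heis \<Rightarrow> heis" where
  "times_heis u v = Heis (ha u + ha v) (hb u + hb v) (hc u + hc v + (ha u * hb v - hb u * ha v))"
definition inverse_heis :: "heis \<Rightarrow> heis" where
  "inverse_heis u = Heis (- ha u) (- hb u) (- hc u)"
definition divide_heis :: "heis \<Rightarrow> heis \<Rightarrow> heis" where
  "divide_heis u v = u * inverse v"

instance
  by standard
    (simp_all add: one_heis_def times_heis_def inverse_heis_def divide_heis_def algebra_simps)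

end

definition heis_of :: "gen2 free \<Rightarrow> heis" where
  "heis_of W = ev W (Heis 1 0 0) (Heis 0 1 0)"

text \<open>\<open>ea\<close> and \<open>eb\<close> are the exponent sums of a and b.
  \<open>ec\<close> is additive up to the determinant of the exponent vectors; its value on the
  commutator of a and b is 2, so it sees what the exponent sums miss.\<close>

definition ea :: "gen2 free \<Rightarrow> int" where "ea W = ha (heis_of W)"
definition eb :: "gen2 free \<Rightarrow> int" where "eb W = hb (heis_of W)"
definition ec :: "gen2 free \<Rightarrow> int" where "ec W = hc (heis_of W)"

lemma exponent_simps [simp]:
  "ea 1 = 0" "ea (u * v) = ea u + ea v" "ea (inverse u) = - ea u" "ea ga = 1" "ea gb = 0"
  "eb 1 = 0" "eb (u * v) = eb u + eb v" "eb (inverse u) = - eb u" "eb ga = 0" "eb gb = 1"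
  "ec 1 = 0" "ec (u * v) = ec u + ec v + (ea u * eb v - eb u * ea v)" "ec (inverse u) = - ec u"
  "ec ga = 0" "ec gb = 0"
  by (simp_all add: ea_def eb_def ec_def heis_of_def one_heis_def times_heis_def inverse_heis_def)

lemma heis_eq_iff: "u = v \<longleftrightarrow> ha u = ha v \<and> hb u = hb v \<and> hc u = hc v"
  by (cases u; cases v) auto

lemma ev_heis:
  "ev W u v = Heis (ea W * ha u + eb W * ha v) (ea W * hb u + eb W * hb v)
     (ea W * hc u + eb W * hc v + ec W * (ha u * hb v - hb u * ha v))"
  by (induction W rule: free2_induct)
    (simp_all add: heis_eq_iff one_heis_def times_heis_def inverse_heis_def algebra_simps)

lemma exponent_ev [simp]:
  "ea (ev W U V) = ea W * ea U + eb W * ea V"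
  "eb (ev W U V) = ea W * eb U + eb W * eb V"
  by (simp_all add: ea_def[of "ev W U V"] eb_def[of "ev W U V"] heis_of_def ev_ev ev_heis[of W])
    (simp_all add: ea_def eb_def heis_of_def)

lemma ec_ev:
  "ec (ev W U V) = ea W * ec U + eb W * ec V + ec W * (ea U * eb V - eb U * ea V)"
  by (simp add: ec_def[of "ev W U V"] heis_of_def ev_ev ev_heis[of W])
    (simp add: ea_def eb_def ec_def heis_of_def)

lemma exponent_power_int [simp]:
  "ea (u powi i) = i * ea u" "eb (u powi i) = i * eb u"
proof -
  have "ea (u powi i) = i * ea u \<and> eb (u powi i) = i * eb u"
  proof (induction i rule: int_induct[where k = 0])
    case (step1 i)
    then show ?case unfolding power_int_add_one_group by (simp add: algebra_simps)
  next
    case (step2 i)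
    then show ?case using power_int_add_one_group[of u "i - 1"] by (simp add: algebra_simps)
  qed simp
  then show "ea (u powi i) = i * ea u" "eb (u powi i) = i * eb u" by auto
qed

lemma ec_power_int [simp]: "ec (u powi i) = i * ec u"
proof (induction i rule: int_induct[where k = 0])
  case (step1 i)
  then show ?case unfolding power_int_add_one_group by (simp add: algebra_simps)
next
  case (step2 i)
  then show ?case using power_int_add_one_group[of u "i - 1"] by (simp add: algebra_simps)
qed simp

text \<open>Powers of one element commute, so only the exponent sums of the word survive. This is
  why evaluations with a trivial or repeated entry collapse.\<close>

lemma ev_power_int: "ev W (u powi i) (u powi j) = u powi (ea W * i + eb W * j)"
  by (induction W rule: free2_induct)
    (simp_all add: algebra_simps flip: power_int_add_group power_int_minus_group)

lemma ev_one_right [simp]: "ev W U 1 = U powi ea W"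
  using ev_power_int[of W U 1 0] by simp

lemma ev_one_left [simp]: "ev W 1 V = V powi eb W"
  using ev_power_int[of W V 0 1] by simp

lemma ev_same: "ev W U U = U powi (ea W + eb W)"
  using ev_power_int[of W U 1 1] by simp

section \<open>Nielsen reduction of pairs\<close>

abbreviation len :: "'g free \<Rightarrow> nat" where "len u \<equiv> length (word_of u)"

lemma cancellation_words:
  assumes "reduced u" "reduced v"
  shows "\<exists>u' c v'. u = u' @ c \<and> v = inv_word c @ v' \<and> reduced (u' @ v')"
  using assms
proof (induction u arbitrary: v rule: rev_induct)
  case Nil
  then show ?case by simp
next
  case (snoc l u)
  show ?case
  proof (cases "v \<noteq> [] \<and> hd v = inv_letter l")
    case True
    then obtain v1 where v: "v = inv_letter l # v1" by (cases v) auto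
    have "reduced u" "reduced v1"
      using snoc.prems v by (auto simp: reduced_append reduced_Cons)
    from snoc.IH[OF this] obtain u' c v'
      where "u = u' @ c" "v1 = inv_word c @ v'" "reduced (u' @ v')" by blast
    then have "u @ [l] = u' @ (c @ [l])" "v = inv_word (c @ [l]) @ v'" "reduced (u' @ v')"
      using v by simp_all
    then show ?thesis by blast
  next
    case False
    then have "reduced ((u @ [l]) @ v)" using snoc.prems by (auto simp: reduced_append reduced_Cons)
    then show ?thesis by (metis append_Nil append_Nil2 inv_word_simps(1))
  qed
qed

lemma word_of_mult_reduced:
  assumes "word_of u = u' @ c" "word_of v = inv_word c @ v'" "reduced (u' @ v')"
  shows "word_of (u * v) = u' @ v'"
proof -
  have "u = free_of (u' @ c)" "v = free_of (inv_word c @ v')"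
    using assms by (metis free_of_word_of)+
  then have "u * v = free_of (u' @ v')"
    by (simp add: free_of_append free_of_inv_word mult.assoc)
  then show ?thesis using assms(3) by simp
qed

lemma cancellation:
  obtains u' c v' where "word_of u = u' @ c" "word_of v = inv_word c @ v'" "word_of (u * v) = u' @ v'"
proof -
  obtain u' c v' where *: "word_of u = u' @ c" "word_of v = inv_word c @ v'" "reduced (u' @ v')"
    using cancellation_words[of "word_of u" "word_of v"] by auto
  from that[OF *(1,2) word_of_mult_reduced[OF *]] show ?thesis .
qed

text \<open>If at least half of \<open>u\<close> cancelled in the square, each letter in the first
  half would be the inverse of its mirror image. In the middle this gives two adjacent cancelling
  letters or a letter equal to its own inverse.\<close>

lemma len_square_less:
  assumes "u \<noteq> 1"
  shows "len u < len (u * u)"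
proof -
  obtain u' c v' where *: "word_of u = u' @ c" "word_of u = inv_word c @ v'" "word_of (u * u) = u' @ v'"
    using cancellation[of u u] by blast
  define w where "w = word_of u"
  have n: "length w = length u' + length c" "length w = length c + length v'" "w \<noteq> []"
    using arg_cong[OF *(1), of length] arg_cong[OF *(2), of length] assms by (simp_all add: w_def)
  have flip: "w ! i = inv_letter (w ! (length w - 1 - i))" if "i < length c" for i
  proof -
    have "w ! i = inv_word c ! i" using *(2) that by (simp add: w_def nth_append)
    also have "\<dots> = inv_letter (c ! (length c - 1 - i))"
      using that by (simp add: inv_word_def rev_nth)
    also have "c ! (length c - 1 - i) = w ! (length w - 1 - i)"
    proof -
      have "length w - 1 - i = length u' + (length c - 1 - i)" using that n(1) by simp
      then show ?thesis using *(1) by (simp add: w_def nth_append)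
    qed
    finally show ?thesis .
  qed
  have "2 * length c < length w"
  proof (rule ccontr)
    assume neg: "\<not> 2 * length c < length w"
    show False
    proof (cases "even (length w)")
      case True
      then obtain k where k: "length w = 2 * Suc k"
        using n(3) by (metis evenE length_0_conv mult_0_right not0_implies_Suc)
      have "w ! k = inv_letter (w ! Suc k)" using flip[of k] k neg by simp
      moreover have "w ! Suc k \<noteq> inv_letter (w ! k)"
      proof -
        have "w = take k w @ w ! k # w ! Suc k # drop (Suc (Suc k)) w"
          using k by (simp add: Cons_nth_drop_Suc)
        moreover have "reduced w" by (simp add: w_def)
        ultimately have "reduced (w ! k # w ! Suc k # drop (Suc (Suc k)) w)"
          by (metis reduced_append)
        then show ?thesis by simp
      qed
      ultimately show False by simp
    next
      case False
      then obtain k where k: "length w = 2 * k + 1" by (elim oddE)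
      then show False using flip[of k] neg by simp
    qed
  qed
  then show ?thesis using n *(3) by (simp add: w_def)
qed

text \<open>Nielsen's conditions, with \<open>l\<close>, \<open>m\<close>, \<open>n\<close> ranging
  over formal letters so that only formal cancellation is excluded. Counting cancelled letters, the
  second condition says that the cancellations on the two sides of \<open>val m\<close> together do
  not use it up.\<close>

definition nielsen_reduced :: "'g free \<Rightarrow> 'g free \<Rightarrow> bool" where
  "nielsen_reduced u v \<longleftrightarrow> (let val = letter_val (case_gen2 u v) in
     (\<forall>l m. m \<noteq> inv_letter l \<longrightarrow>
        len (val l) \<le> len (val l * val m) \<and> len (val m) \<le> len (val l * val m)) \<and>
     (\<forall>l m n. m \<noteq> inv_letter l \<longrightarrow> n \<noteq> inv_letter m \<longrightarrow>
        len (val l) + len (val n) < len (val l * val m) + len (val m * val n)))"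

text \<open>Nielsen reduction as an induction on total length. When the second condition fails
  although no product is shorter, the usual argument compares words in a well-ordering. For two
  generators this failure forces a triple \<open>l\<close>, \<open>m\<close>, \<open>l\<close>, and
  a simultaneous conjugation shortens the pair; hence the case \<open>conj\<close>.\<close>

lemma nielsen_induct [case_names one reduced swap inv mult conj]:
  fixes u v :: "'g free"
  assumes one: "\<And>v. P 1 v"
    and reduced: "\<And>u v. nielsen_reduced u v \<Longrightarrow> P u v"
    and swap: "\<And>u v. P v u \<Longrightarrow> P u v"
    and inv: "\<And>u v. P (inverse u) v \<Longrightarrow> P u v"
    and mult: "\<And>u v. P (u * v) v \<Longrightarrow> P u v"
    and conj: "\<And>h u v. P (h * u * inverse h) (h * v * inverse h) \<Longrightarrow> P u v"
  shows "P u v"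
proof (induction "len u + len v" arbitrary: u v rule: less_induct)
  case less
  let ?val = "letter_val (case_gen2 u v)"
  have vals: "?val (False, Ga) = u" "?val (True, Ga) = inverse u"
    "?val (False, Gb) = v" "?val (True, Gb) = inverse v" by simp_all
  have letter: "l \<in> {(False, Ga), (True, Ga), (False, Gb), (True, Gb)}" for l :: "bool \<times> gen2"
    by (cases l; cases "snd l"; cases "fst l") auto
  have P_letters: "P u v" if lm: "snd l \<noteq> snd m" "P (?val l) (?val m)" for l m
  proof -
    have inv2: "P a b" if "P a (inverse b)" for a b using that inv swap by blast
    consider "?val l \<in> {u, inverse u}" "?val m \<in> {v, inverse v}"
      | "?val l \<in> {v, inverse v}" "?val m \<in> {u, inverse u}"
      using letter[of l] letter[of m] lm(1) by auto
    then show ?thesis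
    proof cases
      case 1
      then show ?thesis using lm(2) inv inv2 by (metis insert_iff empty_iff)
    next
      case 2
      then have "P v u" using lm(2) inv inv2 by (metis insert_iff empty_iff)
      then show ?thesis by (rule swap)
    qed
  qed
  have len_letters: "len (?val l) + len (?val m) = len u + len v" if "snd l \<noteq> snd m" for l m
    using letter[of l] letter[of m] that by auto
  have shorten: "P u v" if "m \<noteq> inv_letter l" "len (?val l * ?val m) < len (?val l)" for l m
  proof -
    have "snd l \<noteq> snd m"
    proof
      assume "snd l = snd m"
      with that have "m = l" by (auto simp: prod_eq_iff)
      with that(2) show False using len_square_less[of "?val l"] by (cases "?val l = 1") auto
    qed
    moreover have "P (?val l * ?val m) (?val m)"
      using less that(2) len_letters[OF \<open>snd l \<noteq> snd m\<close>] by simp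
    ultimately show ?thesis using P_letters mult by blast
  qed
  consider "u = 1" | "v = 1" | "nielsen_reduced u v" | "u \<noteq> 1" "v \<noteq> 1" "\<not> nielsen_reduced u v" by blast
  then show ?case
  proof cases
    case 4
    \<comment> \<open>Inverting the product exchanges its factors, which reduces this to
      \<open>shorten\<close>.\<close>
    have shorten': "P u v" if "m \<noteq> inv_letter l" "len (?val l * ?val m) < len (?val m)" for l m
    proof -
      have "?val (inv_letter m) * ?val (inv_letter l) = inverse (?val l * ?val m)" by simp
      then have "len (?val (inv_letter m) * ?val (inv_letter l)) < len (?val (inv_letter m))"
        using that(2) by (simp del: group_inverse_mult)
      moreover have "inv_letter l \<noteq> inv_letter (inv_letter m)" using that(1) by auto
      ultimately show ?thesis using shorten by blast
    qed
    show ?thesis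
    proof (cases "\<exists>l m. m \<noteq> inv_letter l \<and>
        (len (?val l * ?val m) < len (?val l) \<or> len (?val l * ?val m) < len (?val m))")
      case True
      then show ?thesis using shorten shorten' by blast
    next
      case False
      then have nocut: "len (?val l) \<le> len (?val l * ?val m)" "len (?val m) \<le> len (?val l * ?val m)"
        if "m \<noteq> inv_letter l" for l m
        using that by (meson not_le)+
      then obtain l m n where lmn: "m \<noteq> inv_letter l" "n \<noteq> inv_letter m"
        and long: "len (?val l * ?val m) + len (?val m * ?val n) \<le> len (?val l) + len (?val n)"
        using 4(3) unfolding nielsen_reduced_def Let_def by (meson not_le)
      have val1: "?val k \<noteq> 1" for k using letter[of k] 4 by auto
      obtain l' c m' where c: "word_of (?val l) = l' @ c" "word_of (?val m) = inv_word c @ m'"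
        "word_of (?val l * ?val m) = l' @ m'" by (rule cancellation)
      obtain m'' d n' where d: "word_of (?val m) = m'' @ d" "word_of (?val n) = inv_word d @ n'"
        "word_of (?val m * ?val n) = m'' @ n'" by (rule cancellation)
      \<comment> \<open>Each product is at least as long as its outer factor, so the failure of the
        second condition makes both bounds equalities: exactly half of \<open>?val m\<close> cancels
        on either side.\<close>
      have "len (?val l) = len (?val l * ?val m)" "len (?val n) = len (?val m * ?val n)"
        using nocut(1)[OF lmn(1)] nocut(2)[OF lmn(2)] long by linarith+
      then have half: "length m' = length c" "length m'' = length d"
        using c d by simp_all
      moreover have "length c + length m' = length m'' + length d"
        using arg_cong[OF c(2), of length] arg_cong[OF d(1), of length] by simp
      ultimately have "length m'' = length (inv_word c)" by simp
      then have md: "m'' = inv_word c" "m' = d" using c(2) d(1) by simp_all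
      have cd: "length c = length d" using half md by simp
      have "m \<noteq> l"
      proof
        assume "m = l"
        then have "len (?val m * ?val m) = len (?val m)" using \<open>len (?val l) = _\<close> by simp
        then show False using len_square_less[OF val1[of m]] by simp
      qed
      have "snd l \<noteq> snd m" using \<open>m \<noteq> l\<close> lmn(1) by (auto simp: prod_eq_iff)
      have "n \<noteq> m"
      proof
        assume "n = m"
        then have "len (?val m * ?val m) = len (?val m)" using \<open>len (?val n) = _\<close> by simp
        then show False using len_square_less[OF val1[of m]] by simp
      qed
      then have "snd n \<noteq> snd m" using lmn(2) by (auto simp: prod_eq_iff)
      then have "snd n = snd l" using \<open>snd l \<noteq> snd m\<close> by (metis gen2.exhaust)
      \<comment> \<open>Otherwise the two halves of \<open>?val m\<close> would be inverse to each
        other and \<open>?val m\<close> would be trivial.\<close>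
      have "n = l"
      proof (rule ccontr)
        assume "n \<noteq> l"
        then have "n = inv_letter l" using \<open>snd n = snd l\<close> by (auto simp: prod_eq_iff)
        then have "inv_word (l' @ c) = inv_word d @ n'" using c(1) d(2) by simp
        then have "inv_word c = inv_word d" using cd by simp
        then have "c = d" by (metis inv_word_simps(4))
        then have "?val m = free_of (inv_word d @ d)" using d(1) md by (metis free_of_word_of)
        then have "?val m = 1" by (simp add: free_of_append free_of_inv_word)
        then show False using val1 by simp
      qed
      have "len (?val m) \<le> len (?val l)"
        using nocut(2)[OF lmn(1)] \<open>len (?val l) = _\<close> by simp
      then have "length d \<le> length l'" using c(1,2) md cd by simp
      moreover have "l' @ c = inv_word d @ n'" using c(1) d(2) \<open>n = l\<close> by simp
      ultimately obtain t where t: "l' = inv_word d @ t"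
        by (metis append_eq_append_conv_if append_take_drop_id inv_word_simps(5))
      \<comment> \<open>Both halves of \<open>m\<close> cancel against the same letter \<open>l\<close>; no single Nielsen move is shorter, but
        conjugating by the second half of \<open>m\<close> is.\<close>
      define q where "q = free_of d"
      have vl: "?val l = inverse q * free_of t * free_of c"
        using c(1) t unfolding q_def
        by (metis free_of_append free_of_inv_word free_of_word_of append.assoc)
      have vm: "?val m = inverse (free_of c) * q"
        using c(2) md unfolding q_def by (metis free_of_append free_of_inv_word free_of_word_of)
      have eqs: "q * (?val l * ?val m) * inverse q = free_of t"
        "q * ?val m * inverse q = free_of (d @ inv_word c)"
        by (simp_all add: vl vm mult.assoc free_of_append free_of_inv_word q_def)
      have red_len: "length (red w) \<le> length w" for w :: "'g fword"
      proof (induction w)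
        case (Cons l w)
        have "length (push l (red w)) \<le> Suc (length (red w))" by (cases "red w") auto
        then show ?case using Cons by simp
      qed simp
      have "length d \<noteq> 0" using val1[of m] d(1) half cd by (metis add_eq_0_iff_both_eq_0 length_append length_0_conv word_of_eq_Nil_iff)
      have "len (free_of t) + len (free_of (d @ inv_word c)) < len (?val l) + len (?val m)"
      proof -
        have "len (?val l) = 2 * length d + length t" "len (?val m) = 2 * length d"
          using c(1,2) t cd md by simp_all
        moreover have "len (free_of (d @ inv_word c)) \<le> 2 * length d"
          using red_len[of "d @ inv_word c"] cd by simp
        ultimately show ?thesis
          using red_len[of t] \<open>length d \<noteq> 0\<close> unfolding word_of_free_of by linarith
      qed
      then have "P (free_of t) (free_of (d @ inv_word c))"
        using less len_letters[OF \<open>snd l \<noteq> snd m\<close>] by simp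
      then have "P (?val l * ?val m) (?val m)" using conj[of q] eqs by metis
      then show ?thesis using P_letters[OF \<open>snd l \<noteq> snd m\<close>] mult by blast
    qed
  qed (use one reduced swap in blast)+
qed

text \<open>An invariant for reading the word from left to right: the value ends in a tail
  \<open>T\<close> of the last factor, the inequality says that no admissible next factor cancels
  all of \<open>T\<close>, and the value is at least as long as every factor read so far.\<close>

lemma nielsen_reduced_word_val:
  assumes nr: "nielsen_reduced u v" and "reduced w" "w \<noteq> []"
  defines "val \<equiv> letter_val (case_gen2 u v)"
  shows "\<exists>Z T T'. word_of (word_val (case_gen2 u v) w) = Z @ T \<and> word_of (val (last w)) = T' @ T \<and>
    (\<forall>m. m \<noteq> inv_letter (last w) \<longrightarrow>
       len (val (last w)) + len (val m) < 2 * length T + len (val (last w) * val m)) \<and>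
    (\<forall>l\<in>set w. len (val l) \<le> length (Z @ T))"
  using assms(2,3)
proof (induction w rule: rev_induct)
  case (snoc m w)
  have 1: "len (val l) \<le> len (val l * val m)" "len (val m) \<le> len (val l * val m)"
    if "m \<noteq> inv_letter l" for l m
    using nr that unfolding nielsen_reduced_def Let_def val_def by blast+
  have 2: "len (val l) + len (val n) < len (val l * val m) + len (val m * val n)"
    if "m \<noteq> inv_letter l" "n \<noteq> inv_letter m" for l m n
    using nr that unfolding nielsen_reduced_def Let_def val_def by blast
  show ?case
  proof (cases "w = []")
    case True
    have "len (val m) + len (val n) < 2 * len (val m) + len (val m * val n)"
      if "n \<noteq> inv_letter m" for n
    proof -
      have "len (val m) \<noteq> 0"
        using 2[of m m m] by (cases "val m = 1") auto
      then show ?thesis using 1(2)[OF that] by linarith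
    qed
    then show ?thesis using True
      by - (rule exI[of _ "[]"], rule exI[of _ "word_of (val m)"], simp flip: val_def)
  next
    case False
    let ?l = "last w"
    have "reduced w" and ml: "m \<noteq> inv_letter ?l"
      using snoc.prems(1) False by (auto simp: reduced_append)
    then obtain Z T T' where T: "word_of (word_val (case_gen2 u v) w) = Z @ T"
      "word_of (val ?l) = T' @ T"
      and Tlen: "\<And>m. m \<noteq> inv_letter ?l \<Longrightarrow>
        len (val ?l) + len (val m) < 2 * length T + len (val ?l * val m)"
      and Zlen: "\<forall>l\<in>set w. len (val l) \<le> length (Z @ T)"
      using snoc.IH False by blast
    obtain l' d m' where d: "word_of (val ?l) = l' @ d" "word_of (val m) = inv_word d @ m'"
      "word_of (val ?l * val m) = l' @ m'" by (rule cancellation)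
    have "length d < length T" using Tlen[OF ml] d by simp
    moreover have "T' @ T = l' @ d" using d(1) T(2) by simp
    ultimately obtain T'' where T'': "T = T'' @ d" "T'' \<noteq> []" "l' = T' @ T''"
      unfolding append_eq_append_conv2 by fastforce
    have "reduced (Z @ T'' @ m')"
    proof -
      have "reduced ((Z @ T'') @ d)" using T(1) T''(1) by (metis append.assoc word_of_simps(1))
      then have "reduced (Z @ T'')" using reduced_append by blast
      moreover have "reduced (T' @ T'' @ m')" using d(3) T''(3) by (metis append.assoc word_of_simps(1))
      then have "reduced (T'' @ m')" using reduced_append by blast
      ultimately show ?thesis using T''(2) by (auto simp: reduced_append)
    qed
    then have w: "word_of (word_val (case_gen2 u v) (w @ [m])) = (Z @ T'') @ m'"
      using word_of_mult_reduced[of "word_val (case_gen2 u v) w" "Z @ T''" d "val m" m'] T(1) T''(1) d(2)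
      by (simp add: val_def)
    \<comment> \<open>The new tail \<open>m'\<close> is what the previous factor leaves of
      \<open>val m\<close>; by the second Nielsen condition the next factor cannot cancel all of
      it.\<close>
    have "len (val m) + len (val n) < 2 * length m' + len (val m * val n)" if "n \<noteq> inv_letter m" for n
      using 2[OF ml that] d by simp
    moreover have "len (val k) \<le> length ((Z @ T'') @ m')" if "k \<in> set (w @ [m])" for k
    proof -
      have "len (val ?l) \<le> length Z + length T" using Zlen False by simp
      \<comment> \<open>At most half of either factor cancels. Hence the length does not drop, and
        what remains of the old value is at least as long as the cancelled part \<open>d\<close> of
        \<open>val m\<close>.\<close>
      moreover have "length d \<le> length m'" "2 * length d \<le> len (val ?l)"
        using 1[OF ml] d by auto
      moreover have "k \<in> set w \<Longrightarrow> len (val k) \<le> length Z + length T" using Zlen by simp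
      ultimately show ?thesis using that d(2) T''(1) by auto
    qed
    ultimately show ?thesis using w d(2)
      by - (rule exI[of _ "Z @ T''"], rule exI[of _ m'], auto)
  qed
qed simp

lemma nielsen_reduced_len_ev:
  assumes "nielsen_reduced u v" "l \<in> set (word_of W)"
  shows "len (letter_val (case_gen2 u v) l) \<le> len (ev W u v)"
  using nielsen_reduced_word_val[OF assms(1), of "word_of W"] assms(2)
  by (force simp: ev_def hom_ext_def)

lemma nielsen_reduced_nontrivial:
  assumes "nielsen_reduced u v" "W \<noteq> 1"
  shows "ev W u v \<noteq> 1"
proof
  let ?val = "letter_val (case_gen2 u v)"
  assume *: "ev W u v = 1"
  obtain l where l: "l \<in> set (word_of W)" using assms(2) by (metis list.set_intros(1) neq_Nil_conv word_of_eq_Nil_iff)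
  have "?val l = 1" using nielsen_reduced_len_ev[OF assms(1) l] * by simp
  \<comment> \<open>The second Nielsen condition for three equal letters; it rules out a trivial
    factor.\<close>
  moreover have "2 * len (?val l) < 2 * len (?val l * ?val l)"
    using assms(1) unfolding nielsen_reduced_def Let_def
    by (metis (no_types, lifting) inv_letter_simps(4) mult_2)
  ultimately show False by simp
qed

section \<open>Pairs of elements of a free group\<close>

text \<open>Every Nielsen move amounts to an invertible substitution in \<open>W\<close> or to a
  conjugation, so freeness passes back along it, and so does being two powers of one element. Only
  pairs with a trivial entry and reduced pairs remain.\<close>

lemma free_or_cyclic:
  fixes u v :: "'g free"
  shows "(\<exists>w i j. u = w powi i \<and> v = w powi j) \<or> (\<forall>W. ev W u v = 1 \<longrightarrow> W = 1)"
proof (induction u v rule: nielsen_induct)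
  case (one v)
  then show ?case using power_int_0_right power_int_1_right by metis
next
  case (reduced u v)
  then show ?case using nielsen_reduced_nontrivial by blast
next
  case (swap u v)
  have "ev W u v = 1 \<longrightarrow> W = 1" if *: "\<forall>W. ev W v u = 1 \<longrightarrow> W = 1" for W
  proof
    assume "ev W u v = 1"
    then have "ev (ev W gb ga) v u = 1" by (simp add: ev_ev)
    then have "ev W gb ga = 1" using * by blast
    then have "ev (ev W gb ga) gb ga = 1" by simp
    then show "W = 1" by (simp add: ev_ev)
  qed
  then show ?case using swap by blast
next
  case (inv u v)
  have "ev W u v = 1 \<longrightarrow> W = 1" if *: "\<forall>W. ev W (inverse u) v = 1 \<longrightarrow> W = 1" for W
  proof
    assume "ev W u v = 1"
    then have "ev (ev W (inverse ga) gb) (inverse u) v = 1" by (simp add: ev_ev)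
    then have "ev W (inverse ga) gb = 1" using * by blast
    then have "ev (ev W (inverse ga) gb) (inverse ga) gb = 1" by simp
    then show "W = 1" by (simp add: ev_ev)
  qed
  moreover have "\<exists>w i j. u = w powi i \<and> v = w powi j" if *: "inverse u = w powi i" "v = w powi j" for w i j
    using * by (metis group_inverse_inverse power_int_minus_group)
  ultimately show ?case using inv by blast
next
  case (mult u v)
  have "ev W u v = 1 \<longrightarrow> W = 1" if *: "\<forall>W. ev W (u * v) v = 1 \<longrightarrow> W = 1" for W
  proof
    assume "ev W u v = 1"
    then have "ev (ev W (ga * inverse gb) gb) (u * v) v = 1" by (simp add: ev_ev mult.assoc)
    then have "ev W (ga * inverse gb) gb = 1" using * by blast
    then have "ev (ev W (ga * inverse gb) gb) (ga * gb) gb = 1" by simp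
    then show "W = 1" by (simp add: ev_ev mult.assoc)
  qed
  moreover have "u = w powi (i - j)" if "u * v = w powi i" "v = w powi j" for w i j
  proof -
    have "u = w powi i * inverse (w powi j)" using that by (metis group_eq_mult_inverse_iff)
    then show ?thesis by (metis power_int_add_group power_int_minus_group uminus_add_conv_diff add.commute)
  qed
  ultimately show ?case using mult by blast
next
  case (conj h u v)
  have "u = (inverse h * w * h) powi i"
    if "h * u * inverse h = w powi i" for w i and u :: "'g free"
  proof -
    have "u = inverse h * (h * u * inverse h) * h" by (simp add: mult.assoc)
    then show ?thesis using that power_int_conj[of "inverse h" w i] by simp
  qed
  moreover have "ev W u v = 1 \<longrightarrow> W = 1"
    if *: "\<forall>W. ev W (h * u * inverse h) (h * v * inverse h) = 1 \<longrightarrow> W = 1" for W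
    using * unfolding ev_conj by simp
  ultimately show ?case using conj by blast
qed

lemma relation_imp_cyclic:
  fixes u v :: "'g free"
  assumes "ev W u v = 1" "W \<noteq> 1"
  obtains w i j where "u = w powi i" "v = w powi j"
  using free_or_cyclic[of u v] assms by blast

lemma commute_imp_cyclic:
  fixes u v :: "'g free"
  assumes "u * v = v * u"
  obtains w i j where "u = w powi i" "v = w powi j"
proof -
  let ?W = "ga * gb * inverse ga * inverse gb"
  \<comment> \<open>Both exponent sums of a commutator vanish; \<open>ec\<close> detects it.\<close>
  have "ec ?W \<noteq> ec 1" by simp
  then have "?W \<noteq> 1" by metis
  moreover have "ev ?W u v = (u * v) * inverse (v * u)" by (simp add: mult.assoc)
  then have "ev ?W u v = 1" unfolding assms by (simp only: right_inverse_mult)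
  ultimately show ?thesis using relation_imp_cyclic that by blast
qed

lemma relation_imp_commute:
  fixes u v :: "'g free"
  assumes "ev W u v = 1" "W \<noteq> 1"
  shows "u * v = v * u"
  using relation_imp_cyclic[OF assms] by (metis power_int_commute_group)

lemma commute_gen:
  fixes u :: "'g free"
  assumes "u * gen g = gen g * u"
  obtains k where "u = gen g powi k"
proof -
  from commute_imp_cyclic[OF assms] obtain w i j where w: "u = w powi i" "gen g = w powi j" .
  \<comment> \<open>The total exponent sum of \<open>w\<close>. Identifying all generators gives j *
    n = 1, so j is 1 or -1 and \<open>w\<close> is the generator or its inverse.\<close>
  define n where "n = ea (hom_ext (\<lambda>_. ga) w)"
  have "ea (hom_ext (\<lambda>_. ga) (gen g)) = j * n" unfolding w n_def by simp
  then have jn: "j * n = 1" by simp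
  then have "j * j = 1" by (metis mult_minus_left mult_minus_right minus_minus mult.right_neutral
      zmult_eq_1_iff)
  then have "u = gen g powi (j * i)"
    using w by (metis mult.left_neutral mult.assoc power_int_mult_group)
  then show ?thesis using that by blast
qed

text \<open>The centralizer of a generator consists of its powers. This is the tool that turns braid
  equations into equations between conjugators.\<close>

lemma conj_gen_eq:
  fixes u v :: "'g free"
  assumes "u * gen g * inverse u = v * gen g * inverse v"
  obtains k where "u = v * gen g powi k"
proof -
  have "(inverse v * u) * gen g = inverse v * (u * gen g * inverse u) * u" by (simp add: mult.assoc)
  also have "\<dots> = gen g * (inverse v * u)" unfolding assms by (simp add: mult.assoc)
  finally obtain k where "inverse v * u = gen g powi k" by (rule commute_gen)
  then have "u = v * gen g powi k" by (metis right_inverse_mult_left)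
  then show ?thesis using that by blast
qed

lemma commute_det:
  assumes "u * v = v * u"
  shows "ea u * eb v = eb u * ea v"
proof -
  have "ec (u * v) = ec (v * u)" using assms by simp
  then show ?thesis by (simp add: algebra_simps)
qed

lemma commute_same_exponents:
  assumes "u * v = v * u" "ea u = ea v" "eb u = eb v" "ea u \<noteq> 0 \<or> eb u \<noteq> 0"
  shows "u = v"
proof -
  from commute_imp_cyclic[OF assms(1)] obtain w i j where "u = w powi i" "v = w powi j" .
  then show ?thesis using assms by auto
qed

lemma commute_exponents_zero:
  assumes "u * v = v * u" "ea v = 0" "eb v = 0" "ea u \<noteq> 0 \<or> eb u \<noteq> 0"
  shows "v = 1"
proof -
  from commute_imp_cyclic[OF assms(1)] obtain w i j where "u = w powi i" "v = w powi j" .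
  then show ?thesis using assms by auto
qed

lemma central_imp_one:
  assumes "u * ga = ga * u" "u * gb = gb * u"
  shows "u = 1"
proof -
  obtain i j where "u = ga powi i" "u = gb powi j" using assms commute_gen by metis
  moreover from this have "i = 0" by (metis exponent_power_int(1) exponent_simps(4,5) mult.right_neutral mult_zero_right)
  ultimately show ?thesis by simp
qed

text \<open>Torsion-freeness: a nontrivial element fails to commute with some \<open>v\<close>, and
  together with \<open>v\<close> it then satisfies no nontrivial relation.\<close>

lemma power_int_eq_one:
  fixes u :: "gen2 free"
  assumes "u powi i = 1" "i \<noteq> 0"
  shows "u = 1"
proof (rule ccontr)
  assume "u \<noteq> 1"
  then obtain v where "u * v \<noteq> v * u" using central_imp_one by blast
  moreover have "ga powi i \<noteq> 1"
    using assms(2) exponent_power_int(1)[of ga i] by (metis exponent_simps(1,4) mult.right_neutral)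
  ultimately show False using relation_imp_commute[of "ga powi i" u v] assms(1) by simp
qed

section \<open>Bases of the free group of rank two\<close>

definition generating :: "gen2 free \<Rightarrow> gen2 free \<Rightarrow> bool" where
  "generating u v \<longleftrightarrow> (\<forall>w. \<exists>W. ev W u v = w)"

definition basis :: "gen2 free \<Rightarrow> gen2 free \<Rightarrow> bool" where
  "basis u v \<longleftrightarrow> generating u v \<and> (\<forall>W. ev W u v = 1 \<longrightarrow> W = 1)"

lemma generating_trans:
  assumes "generating u v" "ev U u' v' = u" "ev V u' v' = v"
  shows "generating u' v'"
  using assms unfolding generating_def by (metis ev_ev)

lemma basis_inj: "basis A B \<Longrightarrow> ev U A B = ev V A B \<Longrightarrow> U = V"
  unfolding basis_def
  by (metis ev_simps(2,3) mult_inverse_eq_one_iff)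

lemma basisI:
  assumes "ev A P Q = ga" "ev B P Q = gb" "ev P A B = ga" "ev Q A B = gb"
  shows "basis A B"
  unfolding basis_def generating_def
proof (intro conjI allI impI)
  fix w
  show "\<exists>W. ev W A B = w" by (rule exI[of _ "ev w P Q"]) (simp add: ev_ev assms)
  assume "ev w A B = 1"
  then have "ev (ev w A B) P Q = 1" by simp
  then show "w = 1" by (simp add: ev_ev assms)
qed

lemma basis_inverse:
  assumes "basis A B"
  \<comment> \<open>\<open>P\<close> and \<open>Q\<close> give the inverse automorphism, in the form
    of identities that can be substituted into.\<close>
  obtains P Q where "\<forall>U V :: gen2 free. ev A (ev P U V) (ev Q U V) = U \<and> ev B (ev P U V) (ev Q U V) = V \<and>
    ev P (ev A U V) (ev B U V) = U \<and> ev Q (ev A U V) (ev B U V) = V"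
proof -
  obtain P Q where PQ: "ev P A B = ga" "ev Q A B = gb"
    using assms unfolding basis_def generating_def by meson
  have "ev (ev A P Q) A B = ev ga A B" "ev (ev B P Q) A B = ev gb A B"
    by (simp_all add: ev_ev PQ)
  then have "ev A P Q = ga" "ev B P Q = gb" using basis_inj[OF assms] by blast+
  then show ?thesis using that[of P Q] PQ by (simp flip: ev_ev)
qed

lemma generating_det:
  assumes "generating u v"
  shows "\<bar>ea u * eb v - eb u * ea v\<bar> = 1"
proof -
  obtain U V where UV: "ev U u v = ga" "ev V u v = gb"
    using assms unfolding generating_def by meson
  have *: "ea U * ea u + eb U * ea v = 1" "ea U * eb u + eb U * eb v = 0"
    "ea V * ea u + eb V * ea v = 0" "ea V * eb u + eb V * eb v = 1"
    by (metis UV exponent_ev exponent_simps(4,5,9,10))+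
  have "(ea U * eb V - eb U * ea V) * (ea u * eb v - eb u * ea v) =
    (ea U * ea u + eb U * ea v) * (ea V * eb u + eb V * eb v)
    - (ea U * eb u + eb U * eb v) * (ea V * ea u + eb V * ea v)"
    by (simp add: algebra_simps)
  also have "\<dots> = 1" unfolding * by simp
  finally show ?thesis by (metis dvd_triv_right zdvd1_eq)
qed

section \<open>Bases of F_2 built from two letters without cancellation\<close>

definition letter_pair :: "gen2 free \<Rightarrow> gen2 free \<Rightarrow> bool" where
  "letter_pair c d \<longleftrightarrow> c \<in> {ga, inverse ga} \<and> d \<in> {gb, inverse gb} \<or>
     c \<in> {gb, inverse gb} \<and> d \<in> {ga, inverse ga}"

text \<open>Entries are multiplied by each other and never by inverses, so no exponents cancel; the
  exponent vectors run through a Stern-Brocot tree.\<close>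

inductive positive_pair :: "gen2 free \<Rightarrow> gen2 free \<Rightarrow> gen2 free \<Rightarrow> gen2 free \<Rightarrow> bool" for c d where
  base: "positive_pair c d c d"
| left: "positive_pair c d u v \<Longrightarrow> positive_pair c d (u * v) v"
| right: "positive_pair c d u v \<Longrightarrow> positive_pair c d u (v * u)"

inductive pair_equiv :: "gen2 free \<Rightarrow> gen2 free \<Rightarrow> gen2 free \<Rightarrow> gen2 free \<Rightarrow> bool" for u v where
  refl: "pair_equiv u v u v"
| swap: "pair_equiv u v x y \<Longrightarrow> pair_equiv u v y x"
| inv: "pair_equiv u v x y \<Longrightarrow> pair_equiv u v (inverse x) y"
| conj: "pair_equiv u v x y \<Longrightarrow> pair_equiv u v (h * x * inverse h) (h * y * inverse h)"

text \<open>The form that every generating pair turns out to have. The size of its exponent matrix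
  shows whether any positive move was made, which is how Nielsen's theorem follows.\<close>

definition canonical_pair :: "gen2 free \<Rightarrow> gen2 free \<Rightarrow> bool" where
  "canonical_pair x y \<longleftrightarrow>
     (\<exists>c d u v. letter_pair c d \<and> positive_pair c d u v \<and> pair_equiv u v x y)"

lemma canonical_pair_base:
  "letter_pair c d \<Longrightarrow> positive_pair c d u v \<Longrightarrow> canonical_pair u v"
  unfolding canonical_pair_def using pair_equiv.refl by blast

lemma canonical_pair_swap: "canonical_pair x y \<Longrightarrow> canonical_pair y x"
  unfolding canonical_pair_def using pair_equiv.swap by blast

lemma canonical_pair_inv: "canonical_pair (inverse x) y \<Longrightarrow> canonical_pair x y"
  unfolding canonical_pair_def using pair_equiv.inv by (metis group_inverse_inverse)

lemma canonical_pair_inv_right: "canonical_pair x (inverse y) \<Longrightarrow> canonical_pair x y"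
  using canonical_pair_swap canonical_pair_inv by blast

lemma canonical_pair_conj:
  "canonical_pair x y \<Longrightarrow> canonical_pair (h * x * inverse h) (h * y * inverse h)"
  unfolding canonical_pair_def using pair_equiv.conj by blast

lemma canonical_pair_unconj:
  "canonical_pair (h * x * inverse h) (h * y * inverse h) \<Longrightarrow> canonical_pair x y"
  using canonical_pair_conj[of "h * x * inverse h" "h * y * inverse h" "inverse h"]
  by (simp add: mult.assoc)

lemma canonical_pair_rotate:
  "canonical_pair (x * y) y \<Longrightarrow> canonical_pair (y * x) y"
  "canonical_pair (x * inverse y) y \<Longrightarrow> canonical_pair (inverse y * x) y"
  using canonical_pair_conj[of "x * y" y y] canonical_pair_conj[of "x * inverse y" y "inverse y"]
  by (simp_all add: mult.assoc)

definition nielsen_closed :: "gen2 free \<Rightarrow> gen2 free \<Rightarrow> bool" where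
  "nielsen_closed x y \<longleftrightarrow> canonical_pair (x * y) y \<and> canonical_pair (x * inverse y) y \<and>
     canonical_pair x (y * x) \<and> canonical_pair x (y * inverse x)"

text \<open>Only the divisions are in question. Dividing the entry changed last undoes the last
  move. Dividing the other entry leaves the inverse of the former value of the changed one, and up
  to inversion and conjugation the result is again a positive pair.\<close>

lemma nielsen_closed_positive:
  assumes "letter_pair c d" "positive_pair c d u v"
  shows "nielsen_closed u v"
proof -
  note can = canonical_pair_base[OF assms(1)]
  have "canonical_pair (u * v) v" "canonical_pair u (v * u)"
    using assms can positive_pair.intros by blast+
  moreover have "canonical_pair (u * inverse v) v \<and> canonical_pair u (v * inverse u)"
    using assms(2)
  proof cases
    case base
    \<comment> \<open>There is no move to undo, but the inverse of a letter may serve as the letter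
      itself.\<close>
    have lp: "letter_pair c (inverse d)" "letter_pair (inverse c) d"
      using assms(1) unfolding letter_pair_def by auto
    have "canonical_pair (c * inverse d) (inverse d)" "canonical_pair (inverse c) (d * inverse c)"
      using canonical_pair_base lp positive_pair.intros by metis+
    then show ?thesis
      using base canonical_pair_inv_right[of "c * inverse d" d] canonical_pair_inv[of c "d * inverse c"]
      by simp
  next
    case (left u1)
    have "canonical_pair (v * u1) u1"
      using left can positive_pair.right canonical_pair_swap by blast
    then have "canonical_pair (u1 * v) u1" by (rule canonical_pair_rotate(1))
    then have "canonical_pair (u1 * v) (inverse u1)"
      using canonical_pair_inv_right by simp
    then show ?thesis using left can by (simp add: mult.assoc)
  next
    case (right v1)
    have "canonical_pair (u * v1) v1"
      using right can positive_pair.left by blast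
    then have "canonical_pair v1 (v1 * u)" by (rule canonical_pair_swap[OF canonical_pair_rotate(1)])
    then have "canonical_pair (inverse v1) (v1 * u)"
      using canonical_pair_inv by simp
    then show ?thesis using right can by (simp add: mult.assoc)
  qed
  ultimately show ?thesis unfolding nielsen_closed_def by simp
qed

lemma nielsen_closed_canonical:
  assumes "canonical_pair x y"
  shows "nielsen_closed x y"
proof -
  obtain c d u v where "letter_pair c d" "positive_pair c d u v" and eq: "pair_equiv u v x y"
    using assms unfolding canonical_pair_def by blast
  then have *: "nielsen_closed u v" by (metis nielsen_closed_positive)
  from eq show ?thesis
  proof (induction rule: pair_equiv.induct)
    case refl
    show ?case by (rule *)
  next
    case (swap x y)
    then show ?case unfolding nielsen_closed_def by (simp add: canonical_pair_swap)
  next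
    case (inv x y)
    then have "canonical_pair (inverse y * x) y" "canonical_pair (y * x) y"
      "canonical_pair x (y * inverse x)" "canonical_pair x (y * x)"
      unfolding nielsen_closed_def by (simp_all add: canonical_pair_rotate)
    then show ?case unfolding nielsen_closed_def
      using canonical_pair_inv[of "inverse x * y" y] canonical_pair_inv[of "inverse x * inverse y" y]
        canonical_pair_inv[of "inverse x"] by simp
  next
    case (conj x y h)
    have "h * x * inverse h * (h * y * inverse h) = h * (x * y) * inverse h"
      "h * x * inverse h * inverse (h * y * inverse h) = h * (x * inverse y) * inverse h"
      "h * y * inverse h * (h * x * inverse h) = h * (y * x) * inverse h"
      "h * y * inverse h * inverse (h * x * inverse h) = h * (y * inverse x) * inverse h"
      by (simp_all add: mult.assoc)
    then show ?case
      using conj unfolding nielsen_closed_def by (metis canonical_pair_conj)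
  qed
qed

lemma word_val_cong: "(\<And>l. l \<in> set w \<Longrightarrow> f (snd l) = f' (snd l)) \<Longrightarrow> word_val f w = word_val f' w"
  by (induction w) (auto simp: letter_val_def)

text \<open>Canonical pairs are closed under Nielsen moves and their inverses, so reduced pairs are
  the point. There a factor is no longer than the value of any word in which it occurs; as a and b
  are such values, both entries are single letters.\<close>

lemma generating_canonical: "generating u v \<Longrightarrow> canonical_pair u v"
proof (induction u v rule: nielsen_induct)
  case (one v)
  \<comment> \<open>A pair with a trivial entry has determinant 0.\<close>
  then have "ea v * 0 - 0 = (1::int) \<or> ea v * 0 - 0 = (-1::int)"
    using generating_det[of 1 v] by simp
  then show ?case by simp
next
  case (reduced u v)
  obtain U V where UV: "ev U u v = ga" "ev V u v = gb"
    using reduced(2) unfolding generating_def by meson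
  have det: "ea u * eb v - eb u * ea v \<noteq> 0" using generating_det[OF reduced(2)] by linarith
  \<comment> \<open>Both entries are needed to write a and b: otherwise a and b would be powers of
    one element and commute.\<close>
  have "\<exists>l \<in> set (word_of U) \<union> set (word_of V). snd l = g" for g
  proof (rule ccontr)
    assume no: "\<not> ?thesis"
    show False
    proof (cases g)
      case Ga
      then have "ev W u v = ev W 1 v" if "W \<in> {U, V}" for W
        using no that unfolding ev_def hom_ext_def
        by (intro word_val_cong) (auto split: gen2.split)
      then have "ga = v powi eb U" "gb = v powi eb V" using UV by auto
      then have "ga * gb = gb * ga" by (metis power_int_commute_group)
      then have "ec (ga * gb) = ec (gb * ga)" by simp
      then show False by simp
    next
      case Gb
      then have "ev W u v = ev W u 1" if "W \<in> {U, V}" for W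
        using no that unfolding ev_def hom_ext_def
        by (intro word_val_cong) (auto split: gen2.split)
      then have "ga = u powi ea U" "gb = u powi ea V" using UV by auto
      then have "ga * gb = gb * ga" by (metis power_int_commute_group)
      then have "ec (ga * gb) = ec (gb * ga)" by simp
      then show False by simp
    qed
  qed
  then obtain l m where lm: "l \<in> set (word_of U) \<union> set (word_of V)" "snd l = Ga"
    "m \<in> set (word_of U) \<union> set (word_of V)" "snd m = Gb" by meson
  have "len (letter_val (case_gen2 u v) l) \<le> 1" if "l \<in> set (word_of U) \<union> set (word_of V)" for l
    using nielsen_reduced_len_ev[OF reduced(1), of l] that UV by fastforce
  from this[OF lm(1)] this[OF lm(3)] have "len u \<le> 1" "len v \<le> 1"
    using lm(2,4) by (auto simp: letter_val_def split: if_splits)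
  moreover have "w \<in> {ga, inverse ga, gb, inverse gb}" if w: "len w \<le> 1" "w \<noteq> 1" for w :: "gen2 free"
  proof -
    obtain l where "word_of w = [l]"
    proof (cases "word_of w")
      case (Cons l r)
      then have "r = []" using w(1) by simp
      then show ?thesis using Cons that by blast
    qed (use w(2) in simp)
    then have "w = letter_val gen l" using free_of_Cons[of l "[]"] by (metis free_of_Nil free_of_word_of mult_1_right)
    then show ?thesis by (cases "snd l"; cases "fst l") (simp_all add: letter_val_def)
  qed
  moreover have "u \<noteq> 1" "v \<noteq> 1" using det by auto
  ultimately have "u \<in> {ga, inverse ga, gb, inverse gb}" "v \<in> {ga, inverse ga, gb, inverse gb}" by blast+
  then have "letter_pair u v"
    unfolding letter_pair_def by (elim insertE emptyE) (use det in simp_all)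
  then show ?case using canonical_pair_base positive_pair.base by blast
next
  case (swap u v)
  have "generating v u" by (rule generating_trans[OF swap.prems, of gb _ _ ga]) simp_all
  then show ?case using swap.IH canonical_pair_swap by blast
next
  case (inv u v)
  have "generating (inverse u) v"
    by (rule generating_trans[OF inv.prems, of "inverse ga" _ _ gb]) simp_all
  then show ?case using inv.IH canonical_pair_inv by blast
next
  case (mult u v)
  have "generating (u * v) v"
    by (rule generating_trans[OF mult.prems, of "ga * inverse gb" _ _ gb]) (simp_all add: mult.assoc)
  then have "nielsen_closed (u * v) v" using mult.IH nielsen_closed_canonical by blast
  then show ?case unfolding nielsen_closed_def by (simp add: mult.assoc)
next
  case (conj h u v)
  have "\<exists>W. ev W (h * u * inverse h) (h * v * inverse h) = w" for w
  proof -
    obtain W where "ev W u v = inverse h * w * h" using conj.prems unfolding generating_def by blast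
    then show ?thesis unfolding ev_conj by (intro exI[of _ W]) (simp add: mult.assoc)
  qed
  then show ?case using conj.IH canonical_pair_unconj unfolding generating_def by blast
qed

text \<open>The coefficients count the occurrences of \<open>c\<close> and \<open>d\<close> in
  \<open>u\<close> and \<open>v\<close>. They only grow, so a total of two is possible only before
  the first move.\<close>

lemma positive_pair_exponents:
  assumes "positive_pair c d u v"
  shows "\<exists>p q r s. p \<ge> 0 \<and> q \<ge> 0 \<and> r \<ge> 0 \<and> s \<ge> 0 \<and> p + q \<ge> 1 \<and> r + s \<ge> 1 \<and>
    ea u = p * ea c + q * ea d \<and> eb u = p * eb c + q * eb d \<and>
    ea v = r * ea c + s * ea d \<and> eb v = r * eb c + s * eb d \<and>
    (u = c \<and> v = d \<or> p + q + r + s \<ge> 3)"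
  using assms
proof (induction rule: positive_pair.induct)
  case base
  show ?case by (rule exI[of _ 1], rule exI[of _ 0], rule exI[of _ 0], rule exI[of _ 1]) simp
next
  case (left u v)
  then obtain p q r s where "p \<ge> 0" "q \<ge> 0" "r \<ge> 0" "s \<ge> 0" "p + q \<ge> 1" "r + s \<ge> 1"
    "ea u = p * ea c + q * ea d" "eb u = p * eb c + q * eb d"
    "ea v = r * ea c + s * ea d" "eb v = r * eb c + s * eb d" by blast
  then show ?case
    by - (rule exI[of _ "p + r"], rule exI[of _ "q + s"], rule exI[of _ r], rule exI[of _ s],
      simp add: algebra_simps)
next
  case (right u v)
  then obtain p q r s where "p \<ge> 0" "q \<ge> 0" "r \<ge> 0" "s \<ge> 0" "p + q \<ge> 1" "r + s \<ge> 1"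
    "ea u = p * ea c + q * ea d" "eb u = p * eb c + q * eb d"
    "ea v = r * ea c + s * ea d" "eb v = r * eb c + s * eb d" by blast
  then show ?case
    by - (rule exI[of _ p], rule exI[of _ q], rule exI[of _ "p + r"], rule exI[of _ "q + s"],
      simp add: algebra_simps)
qed

text \<open>Nielsen's theorem. The sum \<open>N\<close> of the absolute exponents is invariant under
  \<open>pair_equiv\<close> and counts the letters of a positive pair. The identity matrix has sum
  2, which leaves no room for a move, so the pair is conjugate to two letters.\<close>

lemma generating_IA:
  assumes "generating u v" "ea u = 1" "eb u = 0" "ea v = 0" "eb v = 1"
  obtains h where "u = h * ga * inverse h" "v = h * gb * inverse h"
proof -
  obtain c d u0 v0 where cd: "letter_pair c d" and pos: "positive_pair c d u0 v0"
    and eq: "pair_equiv u0 v0 u v"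
    using generating_canonical[OF assms(1)] unfolding canonical_pair_def by blast
  define N where "N x y = \<bar>ea x\<bar> + \<bar>eb x\<bar> + \<bar>ea y\<bar> + \<bar>eb y\<bar>" for x y
  from eq have "N u v = N u0 v0"
    by (induction rule: pair_equiv.induct) (auto simp: N_def)
  then have N: "N u0 v0 = 2" using assms by (simp add: N_def)
  have "u0 = c \<and> v0 = d"
  proof -
    obtain p q r s where *: "p \<ge> 0" "q \<ge> 0" "r \<ge> 0" "s \<ge> 0"
      "ea u0 = p * ea c + q * ea d" "eb u0 = p * eb c + q * eb d"
      "ea v0 = r * ea c + s * ea d" "eb v0 = r * eb c + s * eb d"
      "u0 = c \<and> v0 = d \<or> p + q + r + s \<ge> 3"
      using positive_pair_exponents[OF pos] by blast
    have "N u0 v0 = p + q + r + s"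
      using cd unfolding letter_pair_def N_def *(5-8) by (elim disjE conjE insertE emptyE) (use *(1-4) in auto)
    then show ?thesis using N * by linarith
  qed
  then have "letter_pair u0 v0" using cd by simp
  have "\<exists>h c d. letter_pair c d \<and> u = h * c * inverse h \<and> v = h * d * inverse h"
    using eq
  proof (induction rule: pair_equiv.induct)
    case refl
    show ?case using \<open>letter_pair u0 v0\<close>
      by - (rule exI[of _ 1], rule exI[of _ u0], rule exI[of _ v0], simp)
  next
    case (swap x y)
    then show ?case unfolding letter_pair_def by blast
  next
    case (inv x y)
    then obtain h c d where h: "letter_pair c d" "x = h * c * inverse h" "y = h * d * inverse h" by blast
    have "letter_pair (inverse c) d" using h(1) unfolding letter_pair_def by auto
    moreover have "inverse x = h * inverse c * inverse h" using h(2) by (simp add: mult.assoc)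
    ultimately show ?case using h(3) by blast
  next
    case (conj x y k)
    then obtain h c d where "letter_pair c d" "x = h * c * inverse h" "y = h * d * inverse h" by blast
    then show ?case
      by - (rule exI[of _ "k * h"], rule exI[of _ c], rule exI[of _ d], simp add: mult.assoc)
  qed
  then obtain h c' d' where h: "letter_pair c' d'" "u = h * c' * inverse h" "v = h * d' * inverse h"
    by blast
  then have "c' = ga" "d' = gb" using assms(2-) unfolding letter_pair_def by auto
  then show ?thesis using that h by blast
qed

text \<open>Written as words in \<open>A\<close> and \<open>B\<close>, the pair has the identity as
  exponent matrix, because the matrix of \<open>A\<close>, \<open>B\<close> is invertible. Nielsen's
  theorem applies to these words.\<close>

lemma generating_same_exponents:
  assumes "basis A B" "generating U V"
    and "ea U = ea A" "eb U = eb A" "ea V = ea B" "eb V = eb B"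
  obtains h where "U = h * A * inverse h" "V = h * B * inverse h"
proof -
  have gen: "generating A B" using assms(1) unfolding basis_def by blast
  obtain P Q where PQ: "ev P A B = U" "ev Q A B = V" using gen unfolding generating_def by meson
  have "generating P Q"
    unfolding generating_def
  proof
    fix w
    obtain W where "ev W U V = ev w A B" using assms(2) unfolding generating_def by blast
    then have "ev (ev W P Q) A B = ev w A B" by (simp add: ev_ev PQ)
    then have "ev W P Q = w" by (rule basis_inj[OF assms(1)])
    then show "\<exists>W. ev W P Q = w" by blast
  qed
  define p q where "p = ea A" and "q = eb A"
  define r s where "r = ea B" and "s = eb B"
  have det: "p * s - q * r \<noteq> 0" using generating_det[OF gen] unfolding p_def q_def r_def s_def by linarith
  have solve: "m = 0 \<and> n = 0" if "m * p + n * r = 0" "m * q + n * s = 0" for m n :: int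
  proof -
    have "m * (p * s - q * r) = (m * p + n * r) * s - (m * q + n * s) * r"
      "n * (p * s - q * r) = (m * q + n * s) * p - (m * p + n * r) * q"
      by (simp_all add: algebra_simps)
    then have "m * (p * s - q * r) = 0" "n * (p * s - q * r) = 0" unfolding that by simp_all
    then show ?thesis using det by simp
  qed
  have "ea P * p + eb P * r = p" "ea P * q + eb P * s = q"
    "ea Q * p + eb Q * r = r" "ea Q * q + eb Q * s = s"
    using assms(3-) unfolding PQ[symmetric] p_def q_def r_def s_def by simp_all
  then have "(ea P - 1) * p + eb P * r = 0" "(ea P - 1) * q + eb P * s = 0"
    "ea Q * p + (eb Q - 1) * r = 0" "ea Q * q + (eb Q - 1) * s = 0"
    by (simp_all add: algebra_simps)
  from solve[OF this(1,2)] solve[OF this(3,4)]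
  have "ea P = 1" "eb P = 0" "ea Q = 0" "eb Q = 1" by simp_all
  from generating_IA[OF \<open>generating P Q\<close> this]
  obtain h where "P = h * ga * inverse h" "Q = h * gb * inverse h" .
  then have "U = ev h A B * A * inverse (ev h A B)" "V = ev h A B * B * inverse (ev h A B)"
    using PQ by auto
  then show ?thesis using that by blast
qed

section \<open>The braid relation\<close>

definition braided :: "gen2 free \<Rightarrow> gen2 free \<Rightarrow> gen2 free \<Rightarrow> gen2 free \<Rightarrow> bool" where
  "braided A B C D \<longleftrightarrow> (let x = gen X1; y = gen X2; z = gen X3 in
     ev A (ev A x y) (ev C (ev B x y) z) = ev A x (ev C y z) \<and>
     ev B (ev A x y) (ev C (ev B x y) z) = ev C (ev B x (ev C y z)) (ev D y z) \<and>
     ev D (ev B x y) z = ev D (ev B x (ev C y z)) (ev D y z))"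

lemma braided_eqs:
  fixes x y z :: "'h::group_mult"
  assumes "braided A B C D"
  shows "ev A (ev A x y) (ev C (ev B x y) z) = ev A x (ev C y z)"
    and "ev B (ev A x y) (ev C (ev B x y) z) = ev C (ev B x (ev C y z)) (ev D y z)"
    and "ev D (ev B x y) z = ev D (ev B x (ev C y z)) (ev D y z)"
proof -
  let ?h = "hom_ext (case_gen3 x y z)"
  note * = assms[unfolded braided_def Let_def]
  show "ev A (ev A x y) (ev C (ev B x y) z) = ev A x (ev C y z)"
    using arg_cong[OF *[THEN conjunct1], of ?h] by (simp add: hom_ext_ev)
  show "ev B (ev A x y) (ev C (ev B x y) z) = ev C (ev B x (ev C y z)) (ev D y z)"
    using arg_cong[OF *[THEN conjunct2, THEN conjunct1], of ?h] by (simp add: hom_ext_ev)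
  show "ev D (ev B x y) z = ev D (ev B x (ev C y z)) (ev D y z)"
    using arg_cong[OF *[THEN conjunct2, THEN conjunct2], of ?h] by (simp add: hom_ext_ev)
qed

lemma braidedI:
  assumes "\<And>x y z :: gen3 free. ev A (ev A x y) (ev C (ev B x y) z) = ev A x (ev C y z)"
    and "\<And>x y z :: gen3 free.
      ev B (ev A x y) (ev C (ev B x y) z) = ev C (ev B x (ev C y z)) (ev D y z)"
    and "\<And>x y z :: gen3 free. ev D (ev B x y) z = ev D (ev B x (ev C y z)) (ev D y z)"
  shows "braided A B C D"
  unfolding braided_def Let_def by (intro conjI assms)

definition local_rep :: "gen2 free \<Rightarrow> gen2 free \<Rightarrow> gen2 free \<Rightarrow> gen2 free \<Rightarrow> bool" where
  "local_rep A B C D \<longleftrightarrow> basis A B \<and> basis C D \<and> braided A B C D"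

abbreviation swap_gens :: "gen2 free \<Rightarrow> gen2 free" where "swap_gens W \<equiv> ev W gb ga"

lemma swap_gens_swap_gens: "swap_gens (swap_gens W) = W"
  by (simp add: ev_ev)

lemma basis_swap:
  assumes "basis A B"
  shows "basis (swap_gens B) (swap_gens A)"
proof -
  obtain P Q where "\<forall>U V :: gen2 free. ev A (ev P U V) (ev Q U V) = U \<and> ev B (ev P U V) (ev Q U V) = V \<and>
      ev P (ev A U V) (ev B U V) = U \<and> ev Q (ev A U V) (ev B U V) = V"
    by (rule basis_inverse[OF assms])
  then show ?thesis
    by (intro basisI[of _ "swap_gens Q" "swap_gens P"]) (simp_all add: ev_ev)
qed

text \<open>Numbering the generators backwards exchanges the two automorphisms, and with them the
  first and third equations.\<close>

lemma local_rep_swap: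
  assumes "local_rep A B C D"
  shows "local_rep (swap_gens D) (swap_gens C) (swap_gens B) (swap_gens A)"
proof -
  have br: "braided A B C D" using assms unfolding local_rep_def by blast
  have "braided (swap_gens D) (swap_gens C) (swap_gens B) (swap_gens A)"
    \<comment> \<open>The longer side is on the left in the first equation and on the right in the
      third, so the third one is reversed to rewrite towards the shorter side.\<close>
    by (rule braidedI; simp add: ev_ev braided_eqs(1,2)[OF br] braided_eqs(3)[OF br, symmetric])
  then show ?thesis using assms basis_swap unfolding local_rep_def by blast
qed

lemma power_int_sign:
  assumes "e = 1 \<or> e = -1"
  shows "((u::'a::group_mult) powi e) powi e = u"
  using assms by (auto simp: power_int_minus_group simp flip: power_int_mult_group)

text \<open>Conjugating the action by an automorphism inverting some of the generators of the free group
  of rank three. Inverting all three of them is the symmetry called backward.\<close>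

lemma local_rep_twist:
  assumes rep: "local_rep A B C D"
    and e: "e = 1 \<or> e = -1" and f: "f = 1 \<or> f = -1" and d: "d = 1 \<or> d = -1"
  shows "local_rep (ev A (ga powi e) (gb powi f) powi e) (ev B (ga powi e) (gb powi f) powi f)
    (ev C (ga powi f) (gb powi d) powi f) (ev D (ga powi f) (gb powi d) powi d)"
proof -
  note [simp] = power_int_sign[OF e] power_int_sign[OF f] power_int_sign[OF d]
  have br: "braided A B C D" using rep unfolding local_rep_def by blast
  have "braided (ev A (ga powi e) (gb powi f) powi e) (ev B (ga powi e) (gb powi f) powi f)
    (ev C (ga powi f) (gb powi d) powi f) (ev D (ga powi f) (gb powi d) powi d)"
    by (rule braidedI; simp add: ev_ev braided_eqs(1,2)[OF br] braided_eqs(3)[OF br, symmetric])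
  moreover have "basis (ev A (ga powi e) (gb powi f) powi e) (ev B (ga powi e) (gb powi f) powi f)"
    if AB: "basis A B" and "e = 1 \<or> e = -1" "f = 1 \<or> f = -1" for A B and e f :: int
  proof -
    note [simp] = power_int_sign[OF that(2)] power_int_sign[OF that(3)]
    from basis_inverse[OF AB] obtain P Q where "\<forall>U V :: gen2 free.
      ev A (ev P U V) (ev Q U V) = U \<and> ev B (ev P U V) (ev Q U V) = V \<and>
      ev P (ev A U V) (ev B U V) = U \<and> ev Q (ev A U V) (ev B U V) = V" .
    then show ?thesis
      by (intro basisI[of _ "ev P (ga powi e) (gb powi f) powi e" "ev Q (ga powi e) (gb powi f) powi f"])
        (simp_all add: ev_ev)
  qed
  ultimately show ?thesis using rep e f d unfolding local_rep_def by blast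
qed

section \<open>Abelianized solutions\<close>

text \<open>The exponent matrices of \<open>(A, B)\<close> and \<open>(C, D)\<close> have entries
  \<open>p\<close>, \<open>q\<close>, \<open>r\<close>, \<open>s\<close> and \<open>t\<close>,
  \<open>u\<close>, \<open>v\<close>, \<open>w\<close>. If q and v are nonzero, then p = t(1 - s)
  and w = s(1 - t), and for nonzero t the first determinant factors as (1 - s)(t - 1). Being a unit,
  it leaves only 0 and 2 for s and t.\<close>

lemma integer_solutions:
  fixes p q r s t u v w :: int
  assumes h1: "p * p + q * (t * r) = p" and h2: "p * q + q * (t * s) = q * t"
    and h3: "v * s = v * (s * t) + w * v" and h4: "w = v * (s * u) + w * w"
    and h5: "r * p + s * (t * r) = t * r" and h6: "r * q + s * (t * s) = t * (s * t) + u * v"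
    and h7: "s * u = t * (s * u) + u * w"
    and d1: "\<bar>p * s - q * r\<bar> = 1" and d2: "\<bar>t * w - u * v\<bar> = 1"
  shows "(\<exists>e\<in>{1,-1}. p = 1 \<and> q = 0 \<and> r = 0 \<and> s = e \<and> t = e \<and> u = 0 \<and> v = 0 \<and> w = 1)
    \<or> (p = 0 \<and> s = 0 \<and> t = 0 \<and> w = 0 \<and> q * r = u * v \<and> \<bar>q * r\<bar> = 1)
    \<or> (p = 0 \<and> s = 2 \<and> t = 0 \<and> w = 2 \<and> q * r = -1 \<and> u * v = -1)
    \<or> (p = 2 \<and> s = 0 \<and> t = 2 \<and> w = 0 \<and> q * r = -1 \<and> u * v = -1)
    \<or> (p = -2 \<and> s = 2 \<and> t = 2 \<and> w = -2 \<and> q * r = -3)"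
proof -
  have unit: "z = 1 \<or> z = -1" if "y * z = 1 \<or> y * z = -1" for y z :: int
    using that by (metis dvd_triv_right zdvd1_eq dvd_minus_iff abs_eq_iff abs_1 abs_minus_cancel)
  have D1: "p * s - q * r = 1 \<or> p * s - q * r = -1" and D2: "t * w - u * v = 1 \<or> t * w - u * v = -1"
    using d1 d2 by linarith+
  consider (q0) "q = 0" | (v0) "q \<noteq> 0" "v = 0" | (nz) "q \<noteq> 0" "v \<noteq> 0" by blast
  then show ?thesis
  proof cases
    case q0
    then have "p * s = 1 \<or> p * s = -1" using D1 by simp
    then have s: "s = 1 \<or> s = -1" using unit by blast
    have "p \<noteq> 0" using \<open>p * s = 1 \<or> p * s = -1\<close> by auto
    then have p: "p = 1" using h1 q0 by simp
    have "v = 0"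
    proof (rule ccontr)
      assume "v \<noteq> 0"
      have "v * (s - s * t - w) = 0" using h3 by (simp add: algebra_simps)
      then have w: "w = s - s * t" using \<open>v \<noteq> 0\<close> by simp
      \<comment> \<open>The second determinant becomes t(s - 1), which is even since s is 1 or
        -1.\<close>
      have "u * v = s * (t * s) - t * (s * t)" using h6 q0 by simp
      then have "t * w - u * v = t * s - s * s * t" unfolding w by (simp add: algebra_simps)
      then have "2 * t = 1 \<or> 2 * t = -1 \<or> (0::int) = 1" using D2 s by auto
      then show False by presburger
    qed
    then have "t * w = 1 \<or> t * w = -1" using D2 by simp
    then have "w \<noteq> 0" "t \<noteq> 0" by auto
    then have w: "w = 1" using h4 \<open>v = 0\<close> by simp
    then have t: "t = 1 \<or> t = -1" using \<open>t * w = 1 \<or> t * w = -1\<close> by simp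
    have "s * (t * s) = t * (s * t)" using h6 q0 \<open>v = 0\<close> by simp
    then have "t = s" using s t by auto
    moreover have "r = 0" using h5 p s \<open>t = s\<close> by auto
    moreover have "u = 0" using h7 w s \<open>t = s\<close> by auto
    ultimately show ?thesis using q0 \<open>v = 0\<close> p w s by simp
  next
    case v0
    then have "t * w = 1 \<or> t * w = -1" using D2 by simp
    then have "w \<noteq> 0" by auto
    then have w: "w = 1" using h4 v0 by simp
    then have t: "t = 1 \<or> t = -1" using \<open>t * w = 1 \<or> t * w = -1\<close> by simp
    have "q * (p - (t - t * s)) = 0" using h2 by (simp add: algebra_simps)
    then have p: "p = t - t * s" using v0 by simp
    have "t * (p * s - q * r) = t * p * s + (p * p - p)" using h1 by (simp add: algebra_simps)
    also have "\<dots> = t * ((1 - s) * (t - 1))" unfolding p by (simp add: algebra_simps)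
    finally have "p * s - q * r = (1 - s) * (t - 1)" using t by auto
    then have "t - 1 = 1 \<or> t - 1 = -1" using unit[of "1 - s" "t - 1"] D1 by simp
    then have False using t by linarith
    then show ?thesis ..
  next
    case nz
    have "q * (p - (t - t * s)) = 0" using h2 by (simp add: algebra_simps)
    then have p: "p = t - t * s" using nz by simp
    have "v * (s - s * t - w) = 0" using h3 by (simp add: algebra_simps)
    then have w: "w = s - s * t" using nz by simp
    have t: "t = 0 \<or> t = 2" "s = 0 \<or> s = 2" if "t \<noteq> 0"
    proof -
      have "t * (p * s - q * r) = t * p * s + (p * p - p)" using h1 by (simp add: algebra_simps)
      also have "\<dots> = t * ((1 - s) * (t - 1))" unfolding p by (simp add: algebra_simps)
      finally have *: "p * s - q * r = (1 - s) * (t - 1)" using that by simp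
      have "t - 1 = 1 \<or> t - 1 = -1" using unit[of "1 - s" "t - 1"] D1 * by simp
      then show "t = 0 \<or> t = 2" by auto
      have "1 - s = 1 \<or> 1 - s = -1" using unit[of "t - 1" "1 - s"] D1 * by (simp add: mult.commute)
      then show "s = 0 \<or> s = 2" by auto
    qed
    have "s = 0 \<or> s = 2"
    proof (cases "t = 0")
      case True
      then have "w = s" using w by simp
      have uv: "u * v = 1 \<or> u * v = -1" using D2 True by auto
      have "s = s * (u * v) + s * s" using h4 \<open>w = s\<close> by (simp add: algebra_simps)
      then have "s * (u * v + s - 1) = 0" by (simp add: algebra_simps)
      then show ?thesis using uv by auto
    qed (use t in blast)
    moreover have "t = 0 \<or> t = 2" using t by blast
    ultimately consider "s = 0" "t = 0" | "s = 2" "t = 0" | "s = 0" "t = 2" | "s = 2" "t = 2" by blast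
    then show ?thesis
    proof cases
      case 1
      then show ?thesis using p w h6 d1 by (simp add: mult.commute)
    next
      case 2
      then show ?thesis using p w h4 h6 by (simp add: algebra_simps)
    next
      case 3
      then show ?thesis using p w h1 h6 by (simp add: algebra_simps)
    next
      case 4
      then show ?thesis using p w h1 by (simp add: algebra_simps)
    qed
  qed
qed

lemma local_rep_exponents:
  assumes "local_rep A B C D"
  defines "p \<equiv> ea A" and "q \<equiv> eb A" and "r \<equiv> ea B" and "s \<equiv> eb B"
    and "t \<equiv> ea C" and "u \<equiv> eb C" and "v \<equiv> ea D" and "w \<equiv> eb D"
  shows "(\<exists>e\<in>{1,-1}. p = 1 \<and> q = 0 \<and> r = 0 \<and> s = e \<and> t = e \<and> u = 0 \<and> v = 0 \<and> w = 1)
    \<or> (p = 0 \<and> s = 0 \<and> t = 0 \<and> w = 0 \<and> q * r = u * v \<and> \<bar>q * r\<bar> = 1)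
    \<or> (p = 0 \<and> s = 2 \<and> t = 0 \<and> w = 2 \<and> q * r = -1 \<and> u * v = -1)
    \<or> (p = 2 \<and> s = 0 \<and> t = 2 \<and> w = 0 \<and> q * r = -1 \<and> u * v = -1)
    \<or> (p = -2 \<and> s = 2 \<and> t = 2 \<and> w = -2 \<and> q * r = -3)"
proof (rule integer_solutions)
  have br: "braided A B C D" and gen: "generating A B" "generating C D"
    using assms(1) unfolding local_rep_def basis_def by blast+
  note eqs = braided_eqs[OF br, THEN arg_cong[of _ _ ea]]
  \<comment> \<open>With one variable equal to a and the others trivial, \<open>ea\<close> reads off
    a single matrix entry of the abelianized relation.\<close>
  show "p * p + q * (t * r) = p" "p * q + q * (t * s) = q * t"
    using eqs(1)[of ga 1 1] eqs(1)[of 1 ga 1] by (simp_all add: p_def q_def r_def s_def t_def)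
  show "v * s = v * (s * t) + w * v" "w = v * (s * u) + w * w"
    using eqs(3)[of 1 ga 1] eqs(3)[of 1 1 ga]
    by (simp_all add: s_def t_def u_def v_def w_def)
  show "r * p + s * (t * r) = t * r" "r * q + s * (t * s) = t * (s * t) + u * v"
    "s * u = t * (s * u) + u * w"
    using eqs(2)[of ga 1 1] eqs(2)[of 1 ga 1] eqs(2)[of 1 1 ga]
    by (simp_all add: p_def q_def r_def s_def t_def u_def v_def w_def)
  show "\<bar>p * s - q * r\<bar> = 1" "\<bar>t * w - u * v\<bar> = 1"
    using gen[THEN generating_det] by (simp_all add: p_def q_def r_def s_def t_def u_def v_def w_def)
qed

section \<open>Solving the braid relation\<close>

lemma basis_commute:
  assumes "basis A B"
  shows "basis B A"
  unfolding basis_def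
proof
  show "generating B A"
    using assms generating_trans[of A B gb B A ga] unfolding basis_def by simp
  show "\<forall>W. ev W B A = 1 \<longrightarrow> W = 1"
  proof (intro allI impI)
    fix W
    assume "ev W B A = 1"
    then have "ev (swap_gens W) A B = 1" by (simp add: ev_ev)
    then have "swap_gens W = 1" using assms unfolding basis_def by blast
    then show "W = 1" by (metis ev_simps(1) swap_gens_swap_gens)
  qed
qed

text \<open>\<open>u\<close> is a power of some w, and v^k is a nonzero power of the same w. So w
  and \<open>v\<close> satisfy a nontrivial relation and commute.\<close>

lemma commute_power_int_imp_commute:
  fixes u v :: "gen2 free"
  assumes "u * v powi k = v powi k * u" "k \<noteq> 0" "ea v \<noteq> 0"
  shows "u * v = v * u"
proof -
  obtain w i j where w: "u = w powi i" "v powi k = w powi j" using commute_imp_cyclic[OF assms(1)] .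
  have "k * ea v = j * ea w" using w(2) by (metis exponent_power_int(1))
  then have "j \<noteq> 0" using assms by auto
  have "ev (ga powi j * inverse (gb powi k)) w v = 1" using w(2) by simp
  moreover have "ea (ga powi j * inverse (gb powi k)) \<noteq> 0" using \<open>j \<noteq> 0\<close> by simp
  then have "ga powi j * inverse (gb powi k) \<noteq> 1" by (metis exponent_simps(1))
  ultimately have "w * v = v * w" by (rule relation_imp_commute)
  then show ?thesis unfolding w(1) by (rule commute_power_int)
qed

lemma basis_ga_gb: "basis ga gb"
  by (rule basisI[of _ ga gb]) simp_all

lemma generating_of_local_rep:
  assumes "local_rep A B C D"
  shows "generating A B" "generating C D" "basis A B" "basis C D" "braided A B C D"
  using assms unfolding local_rep_def basis_def by blast+

section \<open>Diagonal exponent matrices\<close>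

lemma solve_diagonal_left:
  assumes rep: "local_rep A B C D" and e: "e = 1 \<or> e = -1"
    and ex: "ea A = 1" "eb A = 0" "ea B = 0" "eb B = e" "ea C = e"
  shows "\<exists>m. A = ga \<and> B = ga powi m * gb powi e * ga powi (- m)"
proof -
  note br = generating_of_local_rep(5)[OF rep]
  have "basis ga (gb powi e)"
    by (rule basisI[of _ ga "gb powi e"]) (simp_all add: power_int_sign[OF e])
  then obtain g where g: "A = g * ga * inverse g" "B = g * gb powi e * inverse g"
    by (rule generating_same_exponents[OF _ generating_of_local_rep(1)[OF rep]]) (simp_all add: ex)
  have *: "ev A A (B powi e) = ev A ga (gb powi e)"
    using braided_eqs(1)[OF br, of ga gb 1] ex by simp
  have "g * ga = ga * g"
    using e
  proof
    assume "e = 1"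
    then have "ev A A B = ev ga A B" using * by simp
    then have "A = ga" by (rule basis_inj[OF generating_of_local_rep(3)[OF rep]])
    then show ?thesis using g(1) by (metis group_eq_mult_inverse_iff)
  next
    assume "e = -1"
    \<comment> \<open>A(A, B^-1) is the conjugate of a by g^2 and A(a, b^-1) the one by
      \<open>g2\<close>, so g^2 and \<open>g2\<close> agree up to a power of a. Inverting b once
      more recovers g; substituting yields g a^-k g^2 a^-2k = 1, which forces g and a^-k to
      commute.\<close>
    define g2 where "g2 = ev g ga (inverse gb)"
    have "ev g A (inverse B) = g"
      using ev_conj[of g g ga gb] \<open>e = -1\<close> by (simp add: g power_int_minus_group mult.assoc)
    then have "g * A * inverse g = g2 * ga * inverse g2"
      using * \<open>e = -1\<close> by (simp add: g(1) g2_def power_int_minus_group)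
    then have "(g * g) * ga * inverse (g * g) = g2 * ga * inverse g2"
      by (simp add: g(1) mult.assoc)
    then obtain k where k: "g * g = g2 * ga powi k" by (rule conj_gen_eq)
    then have g2: "g2 = g * g * ga powi (- k)" by (simp add: power_int_minus_group mult.assoc)
    have "ev g2 ga (inverse gb) = g" by (simp add: g2_def ev_ev)
    then have g: "g2 * g2 * ga powi (- k) = g" by (simp add: g2_def[symmetric] g2)
    then have "g * (g * ga powi (- k) * g * g * ga powi (- k) * ga powi (- k)) = g * 1"
      unfolding g2 by (simp add: mult.assoc)
    then have "g * ga powi (- k) * g * g * ga powi (- k) * ga powi (- k) = 1"
      by (simp only: group_mult_left_cancel)
    then have rel: "ev (ga * gb * ga * ga * gb * gb) g (ga powi (- k)) = 1" by (simp add: mult.assoc)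
    show ?thesis
    proof (cases "k = 0")
      case True
      then have "g powi 3 = 1"
        using rel power_int_add_one_group[of g 2] by (simp add: power2_eq_square mult.assoc)
      then show ?thesis using power_int_eq_one[of g 3] by simp
    next
      case False
      have "ea (ga * gb * ga * ga * gb * gb) \<noteq> ea 1" by simp
      then have "ga * gb * ga * ga * gb * gb \<noteq> 1" by metis
      then have "g * ga powi (- k) = ga powi (- k) * g" using relation_imp_commute[OF rel] by blast
      then show ?thesis using commute_power_int_imp_commute[of g ga "- k"] False by simp
    qed
  qed
  then have "A = ga" "\<exists>m. g = ga powi m"
    using g(1) commute_gen by (metis group_eq_mult_inverse_iff, metis)
  then show ?thesis using g(2) by (auto simp: power_int_minus_group)
qed

lemma solve_diagonal:
  assumes rep: "local_rep A B C D" and e: "e = 1 \<or> e = -1"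
    and ex: "ea A = 1" "eb A = 0" "ea B = 0" "eb B = e" "ea C = e" "eb C = 0" "ea D = 0" "eb D = 1"
  shows "A = ga \<and> B = gb powi e \<and> C = ga powi e \<and> D = gb"
proof -
  note br = generating_of_local_rep(5)[OF rep]
  obtain m where m: "A = ga" "B = ga powi m * gb powi e * ga powi (- m)"
    using solve_diagonal_left[OF rep e] ex by auto
  have "\<exists>n. swap_gens D = ga \<and> swap_gens C = ga powi n * gb powi e * ga powi (- n)"
    by (rule solve_diagonal_left[OF local_rep_swap[OF rep] e]) (simp_all add: ex)
  then obtain n where "swap_gens D = ga" "swap_gens C = ga powi n * gb powi e * ga powi (- n)" by blast
  then have n: "D = gb" "C = gb powi n * ga powi e * gb powi (- n)"
    using swap_gens_swap_gens[of D] swap_gens_swap_gens[of C] by simp_all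
  define x y z where "x = gen X1" and "y = gen X2" and "z = gen X3"
  \<comment> \<open>Both sides of the second equation are conjugates of y^e, with conjugators
    \<open>P\<close> and \<open>Q\<close>.\<close>
  define P where "P = x powi m * z powi n * x powi m"
  define Q where "Q = z powi n * x powi m * z powi n"
  have conj: "(h * (w * inverse h)) powi e = h * (w powi e * inverse h)" for h w :: "gen3 free"
    using power_int_conj[of h w e] by (simp add: mult.assoc)
  have conj2: "(h * (k * (w * (inverse k * inverse h)))) powi e = h * (k * (w powi e * (inverse k * inverse h)))"
    for h k w :: "gen3 free"
    using power_int_conj[of "h * k" w e] by (simp add: mult.assoc)
  have "ev B (ev A x y) (ev C (ev B x y) z) = P * y powi e * inverse P"
    by (simp add: m n P_def power_int_minus_group conj conj2 power_int_sign[OF e] mult.assoc)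
  moreover have "ev C (ev B x (ev C y z)) (ev D y z) = Q * y powi e * inverse Q"
    by (simp add: m n Q_def power_int_minus_group conj conj2 power_int_sign[OF e] mult.assoc)
  ultimately have "P * y powi e * inverse P = Q * y powi e * inverse Q"
    using braided_eqs(2)[OF br, of x y z] by simp
  then have "(P * y powi e * inverse P) powi e = (Q * y powi e * inverse Q) powi e" by simp
  then have "P * gen X2 * inverse P = Q * gen X2 * inverse Q"
    by (simp add: conj power_int_sign[OF e] y_def mult.assoc)
  then obtain k where "P = Q * gen X2 powi k" by (rule conj_gen_eq)
  \<comment> \<open>Setting y to 1 removes the unknown power; the exponents then give 2m = m and n =
    2n.\<close>
  then have "hom_ext (case_gen3 ga 1 gb) P = hom_ext (case_gen3 ga 1 gb) (Q * gen X2 powi k)" by simp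
  then have "ga powi m * gb powi n * ga powi m = gb powi n * ga powi m * gb powi n"
    by (simp add: P_def Q_def x_def z_def)
  from arg_cong[OF this, of ea] arg_cong[OF this, of eb] have "m = 0" "n = 0" by simp_all
  then show ?thesis using m n by simp
qed

section \<open>Letterwise automorphisms, and involutions exchanging the elements of a basis up to
  conjugation\<close>

lemma reduced_map:
  assumes "inj \<phi>" "\<And>l. \<phi> (inv_letter l) = inv_letter (\<phi> l)"
  shows "reduced (map \<phi> w) = reduced w"
proof -
  have "\<phi> m = inv_letter (\<phi> l) \<longleftrightarrow> m = inv_letter l" for l m
    using assms by (metis injD)
  then show ?thesis unfolding reduced_iff_successively successively_map by simp
qed

lemma map_letters_free_of:
  assumes "\<And>l. letter_val gen (\<phi> l) = letter_val f l"
  shows "free_of (map \<phi> w) = word_val f w"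
  using assms by (induction w) (simp_all add: free_of_Cons)

lemma swap_letter_simps [simp]:
  "swap_letter (e, Ga) = (e, Gb)" "swap_letter (e, Gb) = (e, Ga)"
  "swap_letter (swap_letter l) = l" "swap_letter l \<noteq> l" "swap_letter l \<noteq> inv_letter l"
  "swap_letter (inv_letter l) = inv_letter (swap_letter l)"
  by (auto simp: swap_letter_def inv_letter_def prod_eq_iff split: gen2.splits)

lemma reduced_map_swap_letter [simp]: "reduced (map swap_letter w) = reduced w"
  by (rule reduced_map) (metis injI swap_letter_simps(3), simp)

lemma free_of_map_swap_letter: "free_of (map swap_letter w) = swap_gens (free_of w)"
proof -
  have "letter_val gen (swap_letter l) = letter_val (case_gen2 gb ga) l" for l
    by (cases l; cases "snd l") (auto simp: letter_val_def)
  then show ?thesis by (simp add: map_letters_free_of ev_def hom_ext_free_of)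
qed

lemma swap_gens_fixed:
  assumes "swap_gens W = W"
  shows "W = 1"
proof -
  have "free_of (map swap_letter (word_of W)) = free_of (word_of W)"
    using assms by (simp add: free_of_map_swap_letter)
  then have "map swap_letter (word_of W) = word_of W" by (intro free_of_inject_reduced) simp_all
  then show ?thesis by (cases "word_of W") auto
qed

text \<open>A cocycle for the group of order two generated by the swap is a coboundary. The
  outermost letters of such a word are \<open>l\<close> and the inverse of the swapped
  \<open>l\<close>, so they can be peeled off into \<open>h\<close>. No single letter is left in the
  middle, since the swap takes no letter to its inverse.\<close>

lemma swap_gens_inverse:
  assumes "g * swap_gens g = 1"
  obtains h where "g = h * inverse (swap_gens h)"
proof -
  have "\<exists>h. free_of w = h * inverse (swap_gens h)" if "map swap_letter w = inv_word w" for w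
    using that
  proof (induction "length w" arbitrary: w rule: less_induct)
    case less
    show ?case
    proof (cases w)
      case Nil
      then show ?thesis by (intro exI[of _ 1]) simp
    next
      case (Cons l r)
      show ?thesis
      proof (cases r rule: rev_cases)
        case Nil
        then show ?thesis using less.prems Cons by simp
      next
        case (snoc r0 m)
        then have *: "inv_letter m = swap_letter l" "map swap_letter r0 = inv_word r0"
          using less.prems Cons by simp_all
        from less.hyps[of r0] Cons snoc *(2) obtain h
          where h: "free_of r0 = h * inverse (swap_gens h)" by auto
        have m: "m = inv_letter (swap_letter l)" using *(1) by (metis inv_letter_simps(1))
        have "letter_val gen (swap_letter l) = swap_gens (letter_val gen l)"
          by (cases l; cases "snd l") (auto simp: letter_val_def)
        then show ?thesis using Cons snoc
          by (intro exI[of _ "letter_val gen l * h"])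
            (simp add: free_of_Cons free_of_append h m mult.assoc)
      qed
    qed
  qed
  moreover have "swap_gens g = inverse g" using assms by (metis inverse_eqI)
  then have "free_of (map swap_letter (word_of g)) = free_of (inv_word (word_of g))"
    by (simp add: free_of_map_swap_letter free_of_inv_word)
  then have "map swap_letter (word_of g) = inv_word (word_of g)"
    by (intro free_of_inject_reduced) simp_all
  ultimately show ?thesis using that by (metis free_of_word_of)
qed

text \<open>In the coboundary form, conjugation by \<open>h\<close> turns the twisted swap into the
  plain one.\<close>

lemma twisted_swap_fixed:
  assumes "g * swap_gens g = 1" "W = g * swap_gens W * inverse g"
  shows "W = 1"
proof -
  obtain h where h: "g = h * inverse (swap_gens h)" using swap_gens_inverse[OF assms(1)] .
  have "W = h * (inverse (swap_gens h) * swap_gens W * swap_gens h) * inverse h"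
    using assms(2) by (simp add: h mult.assoc)
  then have "swap_gens (inverse h * W * h) = inverse h * W * h"
    by (metis (no_types, lifting) ev_simps(2,3) left_inverse_mult_left left_inverse_mult
        mult.assoc mult_1_right)
  from swap_gens_fixed[OF this] show ?thesis
    by (metis group_mult_left_cancel left_inverse_mult mult.assoc mult_1_left right_inverse_mult_left)
qed

text \<open>Up to an inner automorphism the involution interchanges \<open>c\<close> and \<open>d\<close>, and interchanging the two
  letters of a nontrivial word changes the word.\<close>

lemma involution_no_fixed_point:
  fixes c d :: "gen2 free"
  assumes AB: "basis A B" and inv: "ev A A B = ga" "ev B A B = gb" and cd: "basis c d"
    and ex: "ea (ev c A B) = ea d" "eb (ev c A B) = eb d" "ea (ev d A B) = ea c" "eb (ev d A B) = eb c"
    and fixed: "ev f A B = f"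
  shows "f = 1"
proof -
  have surj: "\<exists>W. ev W c d = w" for w using cd unfolding basis_def generating_def by blast
  have "generating (ev c A B) (ev d A B)"
    unfolding generating_def
  proof
    fix w
    obtain W W' where "ev W A B = w" "ev W' c d = W"
      using AB cd unfolding basis_def generating_def by meson
    then have "ev W' (ev c A B) (ev d A B) = w" by (simp flip: ev_ev)
    then show "\<exists>W. ev W (ev c A B) (ev d A B) = w" ..
  qed
  with basis_commute[OF cd] obtain h where h: "ev c A B = h * d * inverse h" "ev d A B = h * c * inverse h"
    using ex by (rule generating_same_exponents)
  obtain g F where g: "h = ev g c d" "f = ev F c d" using surj by metis
  \<comment> \<open>In the coordinates \<open>c\<close>, \<open>d\<close> the automorphism is the
    swap followed by conjugation by \<open>g\<close>.\<close>
  have tau: "ev (ev W c d) A B = ev (g * swap_gens W * inverse g) c d" for W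
    using ev_conj[of W h d c] by (simp add: ev_ev h g(1))
  have tau2: "ev (ev W A B) A B = W" for W by (simp add: ev_ev inv)
  \<comment> \<open>The square of the automorphism is conjugation by \<open>k\<close>. As it is
    trivial, \<open>k\<close> is central, hence 1, and \<open>g\<close> is a cocycle.\<close>
  define k where "k = g * swap_gens g"
  have "ev (k * W * inverse k) c d = ev W c d" for W
    using tau2[of "ev W c d"] by (simp add: tau k_def swap_gens_swap_gens mult.assoc)
  then have "k * W * inverse k = W" for W using basis_inj[OF cd] by blast
  then have "k * W = W * k" for W by (metis group_eq_mult_inverse_iff)
  then have "k = 1" by (intro central_imp_one)
  moreover have "F = g * swap_gens F * inverse g"
  proof (rule basis_inj[OF cd])
    show "ev F c d = ev (g * swap_gens F * inverse g) c d"
      using fixed unfolding g(2) tau by (rule sym)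
  qed
  ultimately have "F = 1" unfolding k_def by (rule twisted_swap_fixed)
  then show ?thesis using g(2) by simp
qed

text \<open>These exponents satisfy all abelianized equations. However \<open>A(a, b\<^sup>2)\<close> is fixed by the automorphism
  \<open>a \<mapsto> A, b \<mapsto> B\<close>; in the Heisenberg group this forces the square of the automorphism, which is
  inner, to be trivial.\<close>

lemma no_sporadic:
  assumes rep: "local_rep A B C D"
    and ex: "ea A = -2" "eb B = 2" "ea C = 2" "eb A * ea B = -3"
  shows False
proof -
  note gen = generating_of_local_rep[OF rep]
  define f where "f = ev A ga (gb * gb)"
  have f: "ev f A B = f"
    using braided_eqs(1)[OF gen(5), of ga gb 1] ex by (simp add: f_def ev_ev power2_eq_square)
  have qr: "eb A * (ea B * z) = -3 * z" "ea B * (eb A * z) = -3 * z" for z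
    using ex(4) by (metis mult.assoc, metis mult.assoc mult.commute)
  have "ec f = ea f * ec A + eb f * ec B + ec f * (ea A * eb B - eb A * ea B)"
    using ec_ev[of f A B] f by simp
  moreover have "ea f = -2" "eb f = 2 * eb A" "ec f = 2 * ec A" by (simp_all add: f_def ec_ev ex)
  ultimately have ec: "eb A * ec B = 3 * ec A" using ex by simp
  \<comment> \<open>The exponent matrix squares to the identity, so the square of the automorphism
    is conjugation by some \<open>k\<close>. That \<open>ec U\<close> and \<open>ec V\<close> vanish
    gives \<open>k\<close> zero exponents; since \<open>k\<close> commutes with \<open>f\<close>,
    whose exponents are not zero, it is trivial.\<close>
  define U V where "U = ev A A B" and "V = ev B A B"
  have UV: "ev (ev W A B) A B = ev W U V" for W by (simp add: U_def V_def ev_ev)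
  have "generating U V"
    unfolding generating_def by (metis UV gen(1) generating_def)
  then obtain k where k: "U = k * ga * inverse k" "V = k * gb * inverse k"
    by (rule generating_IA) (use ex(4) in \<open>simp_all add: U_def V_def ex algebra_simps\<close>)
  have "ec U = 0" using ex(4) by (simp add: U_def ec_ev ex ec algebra_simps)
  then have "eb k = 0" by (simp add: k algebra_simps)
  have "eb A * ec V = 0" using ex(4) ec by (simp add: V_def ec_ev ex algebra_simps qr)
  then have "ec V = 0" using ex(4) by auto
  then have "ea k = 0" by (simp add: k algebra_simps)
  have "f = ev f U V" using f by (simp flip: UV)
  also have "\<dots> = k * f * inverse k" using ev_conj[of f k ga gb] by (simp add: k)
  finally have "f * k = k * f" by (metis group_eq_mult_inverse_iff)
  then have "k = 1"
    using \<open>ea k = 0\<close> \<open>eb k = 0\<close> by (rule commute_exponents_zero) (simp add: f_def ex)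
  then have inv: "ev A A B = ga" "ev B A B = gb" using k by (simp_all add: U_def V_def)
  have "f \<noteq> 1"
  proof
    assume "f = 1"
    then have "ea f = 0" by simp
    then show False by (simp add: f_def ex)
  qed
  have "eb A dvd 3" "ea B dvd 3" using ex(4) by (metis dvd_triv_left dvd_triv_right dvd_minus_iff)+
  have "\<bar>eb A\<bar> = 1 \<or> \<bar>ea B\<bar> = 1"
  proof -
    have "\<bar>eb A\<bar> \<le> 3" using \<open>eb A dvd 3\<close> by (simp add: zdvd_imp_le)
    then have "eb A \<in> {-3, -2, -1, 0, 1, 2, 3}" by auto
    then show ?thesis using ex(4) by auto
  qed
  then show False
  proof
    assume q: "\<bar>eb A\<bar> = 1"
    then have q': "eb A = 1 \<or> eb A = -1" by linarith
    \<comment> \<open>The second element has the exponents (-2, q) of \<open>A\<close>, the image of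
      a. As the exponent matrix is an involution, it exchanges the two exponent vectors.\<close>
    then have "basis ga (inverse (ga * ga) * gb powi eb A)"
      by (intro basisI[of _ ga "(ga * ga * gb) powi eb A"])
        (auto simp: power_int_minus_group mult.assoc)
    from involution_no_fixed_point[OF gen(3) inv this _ _ _ _ f] \<open>f \<noteq> 1\<close> ex(4)
    show False by (simp add: ex)
  next
    assume r: "\<bar>ea B\<bar> = 1"
    then have r': "ea B = 1 \<or> ea B = -1" by linarith
    \<comment> \<open>Likewise with the exponents (r, 2) of \<open>B\<close>, the image of
      b.\<close>
    then have "basis gb (ga powi ea B * (gb * gb))"
      by (intro basisI[of _ "(gb * inverse (ga * ga)) powi ea B" ga])
        (auto simp: power_int_minus_group mult.assoc)
    from involution_no_fixed_point[OF gen(3) inv this _ _ _ _ f] \<open>f \<noteq> 1\<close> ex(4)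
    show False by (simp add: ex algebra_simps)
  qed
qed

lemma ev_conj_gb: "ev (g * gb * inverse g) U V = ev g U V * V * inverse (ev g U V)"
  by simp

section \<open>Antidiagonal exponent matrices\<close>

lemma solve_antidiagonal:
  assumes rep: "local_rep A B C D" and e: "e = 1 \<or> e = -1"
    and ex: "ea A = 0" "eb A = 1" "ea B = e" "eb B = 0" "ea C = 0" "eb C = 1" "ea D = e" "eb D = 0"
  shows "\<exists>n. (e = 1 \<or> n = 0) \<and>
    (A = ga powi n * gb * ga powi (- n) \<and> B = ga powi e \<and> C = A \<and> D = B \<or>
     A = gb \<and> B = gb powi n * ga powi e * gb powi (- n) \<and> C = A \<and> D = B)"
proof -
  note gen = generating_of_local_rep[OF rep]
  note sg [simp] = power_int_sign[OF e]
  have ee [simp]: "e * e = 1" using e by auto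
  have "basis gb (ga powi e)"
    by (rule basisI[of _ "gb powi e" ga]) simp_all
  then obtain g where g: "A = g * gb * inverse g" "B = g * ga powi e * inverse g"
    by (rule generating_same_exponents[OF _ gen(1)]) (simp_all add: ex)
  \<comment> \<open>The first equation at (a, 1, b) expresses \<open>C\<close> by \<open>A\<close>;
    the third one expresses \<open>D\<close> by \<open>B\<close>.\<close>
  have C: "ev C U V = ev A (U powi e) V" for U V :: "'b::group_mult"
  proof -
    have "ev C (ga powi e) gb = A" using braided_eqs(1)[OF gen(5), of ga 1 gb] by (simp add: ex)
    from arg_cong[OF this, of "\<lambda>W. ev W (U powi e) V"] show ?thesis by (simp add: ev_ev)
  qed
  have D: "ev D U V = ev B (U powi e) V powi e" for U V :: "'b::group_mult"
  proof -
    have "ev D (ga powi e) gb = B powi e" using braided_eqs(3)[OF gen(5), of ga 1 gb] by (simp add: ex)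
    from arg_cong[OF this, of "\<lambda>W. ev W (U powi e) V"] show ?thesis by (simp add: ev_ev)
  qed
  have CD: "C = ev A (ga powi e) gb" "D = ev B (ga powi e) gb powi e"
    using C[of ga gb] D[of ga gb] by simp_all
  have Be: "B powi e = g * ga * inverse g" unfolding g(2) power_int_conj by simp
  define m where "m = ea g"
  define x y z where "x = gen X1" and "y = gen X2" and "z = gen X3"
  \<comment> \<open>Both sides of the first equation are conjugates of \<open>x\<^sub>3\<close>; compare the conjugators.\<close>
  define P where "P = ev g (ev A x y) (ev C (ev B x y) z) * ev g (ev B x y powi e) z"
  define Q where "Q = ev g x (ev C y z) * ev g (y powi e) z"
  have "P * gen X3 * inverse P = ev A (ev A x y) (ev C (ev B x y) z)"
    unfolding P_def C by (simp add: g(1) z_def mult.assoc)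
  also have "\<dots> = ev A x (ev C y z)" by (rule braided_eqs(1)[OF gen(5)])
  also have "\<dots> = Q * gen X3 * inverse Q"
    unfolding Q_def C by (simp add: g(1) z_def mult.assoc)
  finally obtain k where "P = Q * gen X3 powi k" by (rule conj_gen_eq)
  \<comment> \<open>Setting z to 1 removes the unknown power and collapses every value of
    \<open>g\<close> to a power with exponent m.\<close>
  then have "hom_ext (case_gen3 ga gb 1) P = hom_ext (case_gen3 ga gb 1) (Q * gen X3 powi k)" by simp
  then have "A powi m * (B powi e) powi m = ga powi m * (gb powi e) powi m"
    by (simp add: P_def Q_def x_def y_def z_def hom_ext_ev ex m_def)
  then have main: "g * (gb powi m * ga powi m) * inverse g = ga powi m * (gb powi e) powi m"
    unfolding Be unfolding g(1) power_int_conj by (simp add: mult.assoc)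
  show ?thesis
  proof (cases "m = 0")
    case False
    have "m = m * e" using arg_cong[OF main, of eb] by simp
    then have "e = 1" using False by simp
    \<comment> \<open>Appending b^m turns the conjugation of b^m a^m into a^m b^m into commutation
      with a^m b^m.\<close>
    define h where "h = g * gb powi m"
    have hc: "h * (ga powi m * gb powi m) = (ga powi m * gb powi m) * h"
    proof -
      have "ga powi m * gb powi m = g * (gb powi m * ga powi m) * inverse g"
        using main \<open>e = 1\<close> by (simp only: power_int_1_right)
      then have "ga powi m * gb powi m * g = g * (gb powi m * ga powi m)"
        unfolding group_eq_mult_inverse_iff .
      from arg_cong[OF this, of "\<lambda>w. w * gb powi m"] show ?thesis by (simp add: h_def mult.assoc)
    qed
    have "eb g = 0" using commute_det[OF hc] False by (simp add: h_def m_def)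
    have "h = ga powi m * gb powi m"
      by (rule commute_same_exponents[OF hc])
        (use False \<open>eb g = 0\<close> in \<open>simp_all add: h_def m_def\<close>)
    then have "g = ga powi m" by (simp add: h_def)
    then have "A = ga powi m * gb * ga powi (- m)" "B = ga"
      using g \<open>e = 1\<close> power_int_commute_group[of ga m 1] by (simp_all add: power_int_minus_group mult.assoc)
    moreover have "C = A" "D = B" using CD \<open>e = 1\<close> by simp_all
    ultimately show ?thesis using \<open>e = 1\<close> by auto
  next
    case True
    define W where "W = ev A (B powi e) gb"
    \<comment> \<open>The first equation at (a, b, b), where C(b, b) = b. It is a relation between
      \<open>A\<close> and \<open>W\<close>, given by the word A a^-1, which is nontrivial because
      its exponent of a is -1.\<close>
    have "ev A A W = A"
      using braided_eqs(1)[OF gen(5), of ga gb gb] by (simp add: W_def C ev_same ex)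
    then have "ev (A * inverse ga) A W = 1" by simp
    moreover have "ea (A * inverse ga) \<noteq> ea 1" by (simp add: ex)
    then have "A * inverse ga \<noteq> 1" by metis
    ultimately have "A * W = W * A" by (rule relation_imp_commute)
    then have "A = W" by (rule commute_same_exponents) (simp_all add: W_def ex)
    \<comment> \<open>The endomorphism \<open>a \<mapsto> B\<^sup>e, b \<mapsto> b\<close> fixes \<open>g\<close> up to a power of \<open>b\<close>, so its image contains
      \<open>g\<^sup>-\<^sup>1B\<^sup>eg = a\<close> and it is an automorphism.\<close>
    define g1 where "g1 = ev g (B powi e) gb"
    have "g1 * gb * inverse g1 = g * gb * inverse g"
      using \<open>A = W\<close> unfolding W_def g1_def by (metis ev_conj_gb g(1))
    then obtain k where k: "g1 = g * gb powi k" by (rule conj_gen_eq)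
    have "eb g1 = eb g" by (simp add: g1_def ex)
    then have "k = 0" using k by simp
    then have g1: "ev g (B powi e) gb = g" using k g1_def by simp
    have "generating (B powi e) gb"
    proof (rule generating_trans[where V = gb])
      show "generating ga gb" using basis_ga_gb unfolding basis_def by blast
      show "ev (inverse g * ga * g) (B powi e) gb = ga" by (simp add: g1) (simp add: Be mult.assoc)
      show "ev gb (B powi e) gb = gb" by simp
    qed
    then obtain h where h: "B powi e = h * ga * inverse h" "gb = h * gb * inverse h"
      by (rule generating_IA) (simp_all add: ex)
    have "h * gb = gb * h" using h(2) by (metis group_eq_mult_inverse_iff)
    then obtain j where j: "h = gb powi j" by (rule commute_gen)
    have "g * ga * inverse g = h * ga * inverse h" using h(1) Be by simp
    then obtain i where "g = h * ga powi i" by (rule conj_gen_eq)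
    moreover from this have "i = 0" using True j by (simp add: m_def)
    ultimately have gj: "g = gb powi j" using j by simp
    then have A: "A = gb" and B: "B = gb powi j * ga powi e * gb powi (- j)"
      using g power_int_commute_group[of gb j 1] by (simp_all add: power_int_minus_group mult.assoc)
    have CA: "C = A" using CD A by simp
    have DB: "D = B"
      using CD(2) unfolding B by (simp add: power_int_conj power_int_minus_group)
    have "e = 1 \<or> j = 0"
    proof (rule ccontr)
      assume "\<not> ?thesis"
      then have e1: "e = -1" and "j \<noteq> 0" using e by auto
      \<comment> \<open>Both sides of the third equation are conjugates of x. With x = 1, counting
        the exponent of y in the conjugators gives j = -j.\<close>
      define P where "P = z powi j * y powi j"
      define Q where "Q = ev D y z powi j * z powi j"
      have "P * gen X1 * inverse P = ev D (ev B x y) z"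
        by (simp add: DB B e1 P_def x_def power_int_minus_group mult.assoc)
      also have "\<dots> = ev D (ev B x (ev C y z)) (ev D y z)" by (rule braided_eqs(3)[OF gen(5)])
      also have "\<dots> = Q * gen X1 * inverse Q"
        by (simp add: DB B CA A e1 Q_def x_def power_int_minus_group mult.assoc)
      finally obtain k where "P = Q * gen X1 powi k" by (rule conj_gen_eq)
      then have "hom_ext (case_gen3 1 ga gb) P = hom_ext (case_gen3 1 ga gb) (Q * gen X1 powi k)" by simp
      from arg_cong[OF this, of ea] show False
        using \<open>j \<noteq> 0\<close> by (simp add: P_def Q_def x_def y_def z_def hom_ext_ev ex e1)
    qed
    then show ?thesis using A B CA DB by blast
  qed
qed

section \<open>Parabolic exponent matrices (determinant 1, trace 2)\<close>

definition starts :: "'g \<Rightarrow> 'g free \<Rightarrow> bool" where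
  "starts g w \<longleftrightarrow> word_of w \<noteq> [] \<and> snd (hd (word_of w)) = g"

text \<open>Applied repeatedly, this finds the first letter of an alternating product of powers of a
  and b; products with different first generators differ.\<close>

lemma starts_power_int_mult:
  assumes "\<not> starts g w" "i \<noteq> 0"
  shows "starts g (gen g powi i * w)"
proof -
  have *: "word_of (letter_val gen (e, g) ^ n * w) = replicate n (e, g) @ word_of w" for e n
  proof (induction n)
    case (Suc n)
    have "letter_val gen (e, g) ^ Suc n * w = free_of ((e, g) # replicate n (e, g) @ word_of w)"
      using Suc by (metis free_of_Cons free_of_word_of mult.assoc power_Suc)
    moreover have "reduced ((e, g) # replicate n (e, g) @ word_of w)"
    proof -
      have "reduced (replicate n (e, g) @ word_of w)" using Suc by (metis word_of_simps(1))
      then show ?thesis using assms(1)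
        by (cases n) (auto simp: reduced_Cons starts_def)
    qed
    ultimately show ?case by (metis Cons_replicate_eq append_Cons red_reduced replicate_Suc word_of_free_of)
  qed simp
  have "\<exists>e n. n \<noteq> 0 \<and> word_of (gen g powi i * w) = replicate n (e, g) @ word_of w"
  proof (cases i rule: int_cases2)
    case (nonneg n)
    then show ?thesis using *[of False n] assms(2)
      by (intro exI[of _ False] exI[of _ n]) (simp add: power_int_of_nat)
  next
    case (nonpos n)
    then show ?thesis using *[of True n] assms(2)
      by (intro exI[of _ True] exI[of _ n]) (simp add: power_int_neg_of_nat power_inverse_group)
  qed
  then obtain e n where "n \<noteq> 0" "word_of (gen g powi i * w) = replicate n (e, g) @ word_of w" by blast
  then show ?thesis by (cases n) (simp_all add: starts_def del: word_of_eq_Nil_iff)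
qed

lemma starts_unique: "starts g w \<Longrightarrow> g \<noteq> h \<Longrightarrow> \<not> starts h w"
  by (auto simp: starts_def)

text \<open>The substitution acts letter by letter and keeps words reduced, so a fixed word contains
  no b.\<close>

lemma fixed_by_inversion:
  assumes "ev g ga (inverse gb) = g"
  shows "g = ga powi ea g"
proof -
  define \<phi> :: "bool \<times> gen2 \<Rightarrow> bool \<times> gen2"
    where "\<phi> l = (if snd l = Gb then inv_letter l else l)" for l
  have "inj \<phi>" by (rule injI) (auto simp: \<phi>_def split: if_splits)
  then have red: "reduced (map \<phi> w) = reduced w" for w
    by (rule reduced_map) (simp add: \<phi>_def)
  have "letter_val gen (\<phi> l) = letter_val (case_gen2 ga (inverse gb)) l" for l
    by (cases l; cases "snd l") (auto simp: \<phi>_def letter_val_def)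
  then have "free_of (map \<phi> (word_of g)) = word_val (case_gen2 ga (inverse gb)) (word_of g)"
    by (rule map_letters_free_of)
  also have "\<dots> = free_of (word_of g)" using assms by (simp add: ev_def hom_ext_def)
  finally have "map \<phi> (word_of g) = word_of g" by (intro free_of_inject_reduced) (simp_all add: red)
  then have "\<forall>l\<in>set (word_of g). \<phi> l = l" by (metis list.map_ident map_eq_conv)
  then have noGb: "\<forall>l\<in>set (word_of g). snd l \<noteq> Gb" by (auto simp: \<phi>_def)
  have "ev g ga gb = ev g ga 1"
    unfolding ev_def hom_ext_def
    by (rule word_val_cong) (use noGb in \<open>auto split: gen2.split\<close>)
  then show ?thesis by simp
qed

lemma solve_parabolic:
  assumes rep: "local_rep A B C D"
    and ex: "ea A = 0" "eb A = 1" "ea B = -1" "eb B = 2" "ea C = 0" "eb C = 1" "ea D = -1" "eb D = 2"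
  shows "A = gb \<and> B = gb * inverse ga * gb \<and> C = gb \<and> D = gb * inverse ga * gb \<or>
    A = ga * gb * inverse ga \<and> B = gb * gb * inverse ga \<and>
      C = inverse ga * gb * ga \<and> D = inverse ga * gb * gb \<or>
    A = inverse ga * gb * ga \<and> B = inverse ga * gb * gb \<and>
      C = ga * gb * inverse ga \<and> D = gb * gb * inverse ga"
proof -
  note gen = generating_of_local_rep[OF rep]
  have "basis gb (gb * inverse ga * gb)"
    by (rule basisI[of _ "ga * inverse gb * ga" ga]) (simp_all add: mult.assoc)
  then obtain g where g: "A = g * gb * inverse g" "B = g * (gb * inverse ga * gb) * inverse g"
    by (rule generating_same_exponents[OF _ gen(1)]) (simp_all add: ex)
  have C: "C = ev A (inverse ga) gb"
  proof -
    have "ev C (inverse ga) gb = A"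
      using braided_eqs(1)[OF gen(5), of ga 1 gb] by (simp add: ex power_int_minus_group)
    from arg_cong[OF this, of "\<lambda>W. ev W (inverse ga) gb"] show ?thesis by (simp add: ev_ev)
  qed
  \<comment> \<open>The second equation at (a, b, 1). With the formula for \<open>C\<close> it says
    that inverting b inverts \<open>A\<close>.\<close>
  have "inverse A = ev C (inverse ga) (inverse gb)"
    using braided_eqs(2)[OF gen(5), of ga gb 1] by (simp add: ex power_int_minus_group)
  then have "inverse (ev A ga (inverse gb)) = A"
    by (simp add: C ev_ev) (metis group_inverse_inverse)
  have D: "D = inverse (ev B (inverse ga) (inverse gb))"
  proof -
    have "inverse B = ev D (inverse ga) (inverse gb)"
      using braided_eqs(3)[OF gen(5), of ga gb 1] by (simp add: ex power_int_minus_group)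
    from arg_cong[OF this, of "\<lambda>W. ev W (inverse ga) (inverse gb)"] show ?thesis by (simp add: ev_ev)
  qed
  define m n where "m = ea g" and "n = eb g"
  have "g = ga powi m * gb powi n"
  proof -
    define g2 where "g2 = ev g ga (inverse gb)"
    have "g2 * gb * inverse g2 = g * gb * inverse g"
      using \<open>inverse (ev A ga (inverse gb)) = A\<close> by (simp add: g(1) g2_def mult.assoc)
    then obtain k where k: "g2 = g * gb powi k" by (rule conj_gen_eq)
    have "eb g2 = - n" by (simp add: g2_def n_def)
    \<comment> \<open>So half of the discrepancy b^k can be moved into g: the element g b^-n is
      fixed when b is inverted, hence a power of a.\<close>
    then have "k = - n + - n" using k by (simp add: n_def)
    then have "ev (g * gb powi (- n)) ga (inverse gb) = g * gb powi (- n)"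
      using k power_int_add_group[of gb "- n + - n" n]
      by (simp add: g2_def[symmetric] power_int_minus_group power_int_inverse_group mult.assoc)
    from fixed_by_inversion[OF this] have "g * gb powi (- n) = ga powi m" by (simp add: m_def)
    then show ?thesis by (metis group_eq_mult_inverse_iff power_int_minus_group)
  qed
  have A: "A = ga powi m * gb * ga powi (- m)"
    using power_int_commute_group[of gb n 1]
    by (simp add: g(1) \<open>g = _\<close> power_int_minus_group mult.assoc)
  define b where "b = gb powi (n + 1) * inverse ga * gb powi (1 - n)"
  have B: "B = ga powi m * b * ga powi (- m)"
    using power_int_add_group[of gb n 1] power_int_add_group[of gb 1 "- n"]
    by (simp add: g(2) \<open>g = _\<close> b_def power_int_minus_group mult.assoc)
  show ?thesis
  proof (cases "m = 0")
    case True
    then have A: "A = gb" and C: "C = gb" using A C by simp_all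
    \<comment> \<open>\<open>D\<close> is \<open>B\<close> read backwards, and reading backwards
      changes the sign of \<open>ec\<close>. So \<open>ec B\<close> vanishes, which forces n =
      0.\<close>
    have "B = D" using braided_eqs(2)[OF gen(5), of 1 ga gb] by (simp add: A C ex)
    then have "ec B = ec (inverse (ev B (inverse ga) (inverse gb)))" using D by simp
    then have "n = 0"
      using True by (simp add: B b_def ec_power_int power_int_inverse_group)
    then have "B = gb * inverse ga * gb" using True by (simp add: B b_def)
    then show ?thesis using A C \<open>B = D\<close> by simp
  next
    case False
    have "ev C (inverse ga) gb = A" unfolding C by (simp add: ev_ev)
    \<comment> \<open>The second equation at (a, 1, b). It makes B^m a^m commute with the square of
      the generator b, and the exponents identify it with the power 2m of b.\<close>
    then have "A * A = ev C B (gb * gb)"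
      using braided_eqs(2)[OF gen(5), of ga 1 gb]
      by (simp add: ex power_int_minus_group power2_eq_square)
    also have "\<dots> = ev A (inverse B) (gb * gb)" unfolding C by (simp add: ev_ev)
    finally have "ga powi m * (gb * gb) * inverse (ga powi m) = inverse (B powi m) * (gb * gb) * B powi m"
      by (simp add: A power_int_minus_group power_int_inverse_group mult.assoc)
    then have "B powi m * (ga powi m * (gb * gb) * inverse (ga powi m)) = (gb * gb) * B powi m"
      by (simp add: mult.assoc)
    then have "B powi m * ga powi m * (gb * gb) = gb * gb * B powi m * ga powi m"
      by (metis (no_types, lifting) left_inverse_mult mult.assoc mult_1_right)
    then have "(gb * gb) * (B powi m * ga powi m) = (B powi m * ga powi m) * (gb * gb)"
      by (simp only: mult.assoc)
    from commute_power_int[OF this, of m]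
    have "(gb * gb) powi m = B powi m * ga powi m"
      by (rule commute_same_exponents) (use False in \<open>simp_all add: ex\<close>)
    moreover have "(gb * gb) powi m = gb powi (2 * m)"
      by (simp add: power_int_mult_group power2_eq_square)
    moreover have "B powi m * ga powi m = ga powi m * b powi m"
      using power_int_conj[of "ga powi m" b m] by (simp add: B power_int_minus_group mult.assoc)
    ultimately have "b powi m = ga powi (- m) * gb powi (2 * m)"
      by (simp add: power_int_minus_group)
    \<comment> \<open>The local \<open>b\<close> commutes with its m-th power, now known explicitly;
      the extra factor cancels the last factor of \<open>b\<close>.\<close>
    moreover have "b * b powi m * gb powi (n - 1) = b powi m * b * gb powi (n - 1)"
      using power_int_commute_group[of b 1 m] by simp
    ultimately have "b * (ga powi (- m) * gb powi (2 * m)) * gb powi (n - 1)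
        = ga powi (- m) * gb powi (2 * m) * b * gb powi (n - 1)" by simp
    then have E: "gb powi (n + 1) * (ga powi (- 1) * (gb powi (1 - n) * (ga powi (- m) * gb powi (2 * m + n - 1))))
        = ga powi (- m) * (gb powi (2 * m + n + 1) * ga powi (- 1))"
      using power_int_add_group[of gb "2 * m" "n - 1"] power_int_add_group[of gb "2 * m" "n + 1", folded add.assoc]
        power_int_add_group[of gb "1 - n" "n - 1"]
      by (simp add: b_def power_int_minus_group mult.assoc add_diff_eq)
    have no: "\<not> starts g (gen h powi k)" if "g \<noteq> h" for g h :: gen2 and k
    proof (cases "k = 0")
      case True
      then show ?thesis by (simp add: starts_def)
    next
      case False
      have "starts h (gen h powi k * 1)"
        by (rule starts_power_int_mult) (simp_all add: starts_def False)
      then show ?thesis using starts_unique that by fastforce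
    qed
    have a: "starts Ga (ga powi i * w)" if "i \<noteq> 0" "\<not> starts Ga w" for i w
      using that by (rule starts_power_int_mult[rotated])
    have b: "starts Gb (gb powi i * w)" if "i \<noteq> 0" "\<not> starts Gb w" for i w
      using that by (rule starts_power_int_mult[rotated])
    have ab: "\<not> (starts Ga w \<and> starts Gb w)" for w :: "gen2 free"
      using starts_unique by fastforce
    define L where "L = ga powi (- m) * gb powi (2 * m + n - 1)"
    have L: "starts Ga L" unfolding L_def by (rule a) (use False no in auto)
    have "m = 1 \<and> n = -1 \<or> m = -1 \<and> n = 1"
    proof (rule ccontr)
      assume neg: "\<not> ?thesis"
      \<comment> \<open>In general the left side of \<open>E\<close> starts with the generator b and
        the right side with a. Vanishing exponents need separate arguments; for n = -1 the equation
        is first multiplied by a.\<close>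
      show False
      proof (cases "n = -1")
        case True
        have "ga * (ga powi (- m) * (gb powi (2 * m) * ga powi (- 1))) = gb powi 2 * L"
          using arg_cong[OF E, of "\<lambda>w. ga * w"] True
          by (simp add: L_def power_int_minus_group)
        then have "ga powi (1 - m) * (gb powi (2 * m) * ga powi (- 1)) = gb powi 2 * L"
          using power_int_add_group[of ga 1 "- m"] by (simp add: mult.assoc)
        moreover have "starts Gb (gb powi 2 * L)" by (rule b) (use L ab in auto)
        moreover have "starts Gb (gb powi (2 * m) * ga powi (- 1))"
          by (rule b[OF _ no]) (use False in simp_all)
        then have "starts Ga (ga powi (1 - m) * (gb powi (2 * m) * ga powi (- 1)))"
          by (intro a) (use neg True ab in auto)
        ultimately show False using ab by metis
      next
        case n: False
        have "starts Ga (ga powi (- 1) * (gb powi (1 - n) * L))"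
        proof (cases "n = 1")
          case True
          then have "ga powi (- 1) * (gb powi (1 - n) * L) = ga powi (- 1 + - m) * gb powi (2 * m)"
            unfolding power_int_add_group by (simp add: L_def mult.assoc)
          then show ?thesis using neg True no by (simp add: a)
        next
          case False
          then have "starts Gb (gb powi (1 - n) * L)" by (intro b) (use L ab in auto)
          then show ?thesis by (intro a) (use ab in auto)
        qed
        then have "starts Gb (gb powi (n + 1) * (ga powi (- 1) * (gb powi (1 - n) * L)))"
          by (intro b) (use n ab in auto)
        moreover have "starts Ga (ga powi (- m) * (gb powi (2 * m + n + 1) * ga powi (- 1)))"
        proof (cases "2 * m + n + 1 = 0")
          case True
          have "ga powi (- m) * (gb powi (2 * m + n + 1) * ga powi (- 1)) = ga powi (- m + - 1) * 1"
            unfolding power_int_add_group True by simp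
          moreover have "- m + - 1 \<noteq> 0" using neg True by auto
          ultimately show ?thesis using a[of "- m + - 1" 1] by (simp add: starts_def)
        next
          case nz: False
          have "starts Gb (gb powi (2 * m + n + 1) * ga powi (- 1))" by (rule b[OF nz no]) simp
          then show ?thesis by (intro a) (use False ab in auto)
        qed
        ultimately show False using E ab unfolding L_def by metis
      qed
    qed
    then show ?thesis
    proof (elim disjE conjE)
      assume mn: "m = 1" "n = -1"
      have "A = ga * gb * inverse ga" "B = gb * gb * inverse ga"
        by (simp_all add: A B b_def mn power_int_minus_group power2_eq_square mult.assoc)
      then show ?thesis by (simp add: C D mult.assoc)
    next
      assume mn: "m = -1" "n = 1"
      have "A = inverse ga * gb * ga" "B = inverse ga * gb * gb"
        by (simp_all add: A B b_def mn power_int_minus_group power2_eq_square mult.assoc)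
      then show ?thesis by (simp add: C D mult.assoc)
    qed
  qed
qed

section \<open>Words and free group elements\<close>

lemma subst_eq_hom_ext: "subst f w = word_of (hom_ext (\<lambda>g. free_of (f g)) (free_of w))"
proof -
  let ?c = "concat (map (\<lambda>l. if fst l then inv_word (f (snd l)) else f (snd l)) w)"
  have "free_of ?c = hom_ext (\<lambda>g. free_of (f g)) (free_of w)"
    unfolding hom_ext_free_of
    by (induction w) (simp_all add: free_of_append free_of_inv_word letter_val_def)
  from arg_cong[OF this, of word_of] show ?thesis unfolding subst_def word_of_free_of .
qed

lemma subst_pair_end: "subst (pair_end A B) w = word_of (ev (free_of w) (free_of A) (free_of B))"
proof -
  have "(\<lambda>g. free_of (pair_end A B g)) = case_gen2 (free_of A) (free_of B)"
    by (rule ext) (simp add: pair_end_def split: gen2.split)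
  then show ?thesis by (simp add: subst_eq_hom_ext ev_def)
qed

lemma is_aut_iff_basis: "is_aut (pair_end A B) \<longleftrightarrow> basis (free_of A) (free_of B)"
proof
  assume aut: "is_aut (pair_end A B)"
  have "generating (free_of A) (free_of B)"
    unfolding generating_def
  proof
    fix w
    obtain w' where "subst (pair_end A B) w' = word_of w"
      using aut unfolding is_aut_def bij_betw_def
      by (metis (no_types, lifting) image_iff mem_Collect_eq word_of_simps(1))
    then have "ev (free_of w') (free_of A) (free_of B) = w" by (simp add: subst_pair_end)
    then show "\<exists>W. ev W (free_of A) (free_of B) = w" ..
  qed
  moreover have "W = 1" if "ev W (free_of A) (free_of B) = 1" for W
  proof -
    have "subst (pair_end A B) (word_of W) = subst (pair_end A B) []"
      using that by (simp add: subst_pair_end)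
    moreover have "inj_on (subst (pair_end A B)) {w. reduced w}"
      using aut unfolding is_aut_def bij_betw_def by blast
    ultimately have "word_of W = []" by (elim inj_onD) simp_all
    then show ?thesis by simp
  qed
  ultimately show "basis (free_of A) (free_of B)" unfolding basis_def by blast
next
  assume bas: "basis (free_of A) (free_of B)"
  have "inj_on (subst (pair_end A B)) {w. reduced w}"
    using basis_inj[OF bas] by (auto intro!: inj_onI simp: subst_pair_end intro: free_of_inject_reduced)
  moreover have "subst (pair_end A B) ` {w. reduced w} = {w. reduced w}"
  proof (intro equalityI subsetI)
    fix w :: "gen2 fword"
    assume "w \<in> {w. reduced w}"
    then have w: "w = word_of (free_of w)" by simp
    obtain W where "ev W (free_of A) (free_of B) = free_of w"
      using bas unfolding basis_def generating_def by blast
    then have "subst (pair_end A B) (word_of W) = w" using w by (simp add: subst_pair_end)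
    then show "w \<in> subst (pair_end A B) ` {w. reduced w}" by force
  qed (auto simp: subst_pair_end)
  ultimately show "is_aut (pair_end A B)" unfolding is_aut_def bij_betw_def by blast
qed

lemma free_of_evalW: "free_of (evalW W U V) = ev (free_of W) (free_of U) (free_of V)"
proof -
  have "evalW W U V = word_of (hom_ext (\<lambda>g. free_of (case g of Ga \<Rightarrow> U | Gb \<Rightarrow> V)) (free_of W))"
    by (simp add: evalW_def subst_eq_hom_ext)
  moreover have "(\<lambda>g. free_of (case g of Ga \<Rightarrow> U | Gb \<Rightarrow> V)) = case_gen2 (free_of U) (free_of V)"
    by (rule ext) (simp split: gen2.split)
  ultimately show ?thesis by (simp add: ev_def)
qed

lemma local_braid_rep_iff:
  "local_braid_rep (A, B, C, D) \<longleftrightarrow> local_rep (free_of A) (free_of B) (free_of C) (free_of D)"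
proof -
  let ?s1 = "s1_of (A, B, C, D)" and ?s2 = "s2_of (A, B, C, D)"
  let ?h1 = "hom_ext (\<lambda>g. free_of (?s1 g))" and ?h2 = "hom_ext (\<lambda>g. free_of (?s2 g))"
  have all3: "(\<forall>g. P g) \<longleftrightarrow> P X1 \<and> P X2 \<and> P X3" for P
    by (metis (full_types) gen3.exhaust)
  have xg: "free_of (Defs.x g) = gen g" for g by (simp add: Defs.x_def gen_def)
  have s1: "free_of (?s1 X1) = ev (free_of A) (gen X1) (gen X2)"
    "free_of (?s1 X2) = ev (free_of B) (gen X1) (gen X2)" "free_of (?s1 X3) = gen X3"
    and s2: "free_of (?s2 X1) = gen X1" "free_of (?s2 X2) = ev (free_of C) (gen X2) (gen X3)"
    "free_of (?s2 X3) = ev (free_of D) (gen X2) (gen X3)"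
    by (simp_all add: s1_of_def s2_of_def free_of_evalW xg)
  have "comp_end ?s1 (comp_end ?s2 ?s1) = comp_end ?s2 (comp_end ?s1 ?s2) \<longleftrightarrow>
    (\<forall>g. ?h1 (?h2 (free_of (?s1 g))) = ?h2 (?h1 (free_of (?s2 g))))"
    by (simp add: comp_end_def fun_eq_iff subst_eq_hom_ext)
  also have "\<dots> \<longleftrightarrow> braided (free_of A) (free_of B) (free_of C) (free_of D)"
    unfolding all3 by (simp add: s1 s2 hom_ext_ev braided_def Let_def)
  finally show ?thesis by (simp add: local_braid_rep_def local_rep_def is_aut_iff_basis)
qed

section \<open>The natural symmetries on free group elements\<close>

definition backward :: "gen2 free \<Rightarrow> gen2 free" where
  "backward W = inverse (ev W (inverse ga) (inverse gb))"

lemma free_of_rev: "free_of (rev w) = backward (free_of w)"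
proof (induction w)
  case (Cons l w)
  have "letter_val gen l = inverse (ev (letter_val gen l) (inverse ga) (inverse gb))"
    by (cases l; cases "snd l") (auto simp: letter_val_def)
  then show ?case using Cons by (simp add: free_of_append free_of_Cons backward_def)
qed (simp add: backward_def)

lemma reduced_rev [simp]: "reduced (rev w) = reduced w"
proof -
  have "rev w = inv_word (map inv_letter w)" by (simp add: inv_word_def o_def)
  moreover have "reduced (map inv_letter w) = reduced w" by (rule reduced_map) (auto intro: injI)
  ultimately show ?thesis by simp
qed

lemma local_rep_backward:
  "local_rep A B C D \<Longrightarrow> local_rep (backward A) (backward B) (backward C) (backward D)"
  using local_rep_twist[of A B C D "-1" "-1" "-1"] by (simp add: backward_def power_int_minus_group)

text \<open>As a Yang--Baxter equation for maps on triples the braid relation visibly passes to inverses.\<close>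

definition act_left :: "gen2 free \<Rightarrow> gen2 free \<Rightarrow> 'h \<times> 'h \<times> 'h \<Rightarrow> 'h \<times> 'h \<times> 'h::group_mult" where
  "act_left A B = (\<lambda>(x, y, z). (ev A x y, ev B x y, z))"

definition act_right :: "gen2 free \<Rightarrow> gen2 free \<Rightarrow> 'h \<times> 'h \<times> 'h \<Rightarrow> 'h \<times> 'h \<times> 'h::group_mult" where
  "act_right C D = (\<lambda>(x, y, z). (x, ev C y z, ev D y z))"

lemma braided_iff_act:
  "braided A B C D \<longleftrightarrow> (\<forall>t :: gen3 free \<times> gen3 free \<times> gen3 free.
     act_left A B (act_right C D (act_left A B t)) = act_right C D (act_left A B (act_right C D t)))"
proof
  assume br: "braided A B C D"
  show "\<forall>t :: gen3 free \<times> gen3 free \<times> gen3 free.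
     act_left A B (act_right C D (act_left A B t)) = act_right C D (act_left A B (act_right C D t))"
    by (simp add: act_left_def act_right_def braided_eqs(1,2)[OF br] braided_eqs(3)[OF br, symmetric])
next
  assume "\<forall>t :: gen3 free \<times> gen3 free \<times> gen3 free.
     act_left A B (act_right C D (act_left A B t)) = act_right C D (act_left A B (act_right C D t))"
  then show "braided A B C D"
    by (intro braidedI) (simp_all add: act_left_def act_right_def)
qed

definition inverse_pair :: "gen2 free \<Rightarrow> gen2 free \<Rightarrow> gen2 free \<Rightarrow> gen2 free \<Rightarrow> bool" where
  "inverse_pair A B P Q \<longleftrightarrow> ev A P Q = ga \<and> ev B P Q = gb \<and> ev P A B = ga \<and> ev Q A B = gb"

lemma inverse_pair_sym: "inverse_pair A B P Q \<Longrightarrow> inverse_pair P Q A B"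
  by (simp add: inverse_pair_def)

lemma inverse_pair_basis: "inverse_pair A B P Q \<Longrightarrow> basis A B"
  unfolding inverse_pair_def by (intro basisI) auto

lemma basis_imp_inverse_pair:
  assumes "basis A B" "ev P A B = ga" "ev Q A B = gb"
  shows "inverse_pair A B P Q"
proof -
  have "ev (ev A P Q) A B = ev ga A B" "ev (ev B P Q) A B = ev gb A B"
    using assms by (simp_all add: ev_ev)
  then show ?thesis
    unfolding inverse_pair_def using assms(2,3) basis_inj[OF assms(1)] by blast
qed

lemma inverse_pair_act:
  assumes "inverse_pair A B P Q"
  shows "act_left A B (act_left P Q t) = t" "act_right A B (act_right P Q t) = t"
proof -
  have "ev A (ev P U V) (ev Q U V) = U" "ev B (ev P U V) (ev Q U V) = V" for U V :: 'a
    using assms unfolding inverse_pair_def by (metis ev_ev ev_simps(5,6))+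
  then show "act_left A B (act_left P Q t) = t" "act_right A B (act_right P Q t) = t"
    by (simp_all add: act_left_def act_right_def split: prod.split)
qed

lemma local_rep_inverse:
  assumes "local_rep A B C D" and AB: "inverse_pair A B P Q" and CD: "inverse_pair C D R S"
  shows "local_rep P Q R S"
proof -
  have *: "act_left A B (act_right C D (act_left A B t)) = act_right C D (act_left A B (act_right C D t))"
    for t :: "gen3 free \<times> gen3 free \<times> gen3 free"
    using assms(1) unfolding local_rep_def braided_iff_act by blast
  note [simp] = inverse_pair_act[OF AB] inverse_pair_act[OF CD]
    inverse_pair_act[OF inverse_pair_sym[OF AB]] inverse_pair_act[OF inverse_pair_sym[OF CD]]
  have "braided P Q R S"
    unfolding braided_iff_act
  proof
    fix t :: "gen3 free \<times> gen3 free \<times> gen3 free"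
    define u where "u = act_left P Q (act_right R S (act_left P Q t))"
    have "act_right C D (act_left A B (act_right C D u)) = t"
      unfolding *[symmetric] by (simp add: u_def)
    then have "act_right R S (act_left P Q (act_right R S t)) = u" by auto
    then show "act_left P Q (act_right R S (act_left P Q t)) = act_right R S (act_left P Q (act_right R S t))"
      by (simp add: u_def)
  qed
  then show ?thesis
    unfolding local_rep_def using AB CD inverse_pair_sym inverse_pair_basis by blast
qed

text \<open>The substitution is injective on reduced words, so \<open>inv_into\<close> returns the
  only reduced preimage.\<close>

lemma sym_inverse_eq:
  assumes "inverse_pair (free_of A) (free_of B) P Q" "inverse_pair (free_of C) (free_of D) R S"
  shows "sym_inverse (A, B, C, D) = (word_of P, word_of Q, word_of R, word_of S)"
proof -
  have *: "aut_inv_img (pair_end A B) g = word_of P"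
    if "basis (free_of A) (free_of B)" "ev P (free_of A) (free_of B) = gen g" for A B P g
  proof -
    have "inj_on (subst (pair_end A B)) {w. reduced w}"
      using that(1) is_aut_iff_basis unfolding is_aut_def bij_betw_def by blast
    then show ?thesis
      unfolding aut_inv_img_def by (rule inv_into_f_eq) (simp_all add: subst_pair_end that(2))
  qed
  show ?thesis
    using assms[THEN inverse_pair_basis] assms unfolding sym_inverse_def inverse_pair_def
    by (simp add: *)
qed

section \<open>The listed quadruples\<close>

lemma free_of_replicate:
  "free_of (replicate r la) = ga powi int r" "free_of (replicate r lA) = ga powi (- int r)"
proof -
  have "free_of (replicate r la) = ga ^ r" "free_of (replicate r lA) = inverse ga ^ r"
    by (induction r) (simp_all add: free_of_Cons)
  then show "free_of (replicate r la) = ga powi int r" "free_of (replicate r lA) = ga powi (- int r)"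
    by (simp_all add: power_int_of_nat power_int_neg_of_nat power_inverse_group)
qed

lemmas free_of_word = free_of_Cons free_of_append free_of_replicate

lemma local_rep_T: "local_rep ga gb ga gb"
  unfolding local_rep_def by (intro conjI basis_ga_gb braidedI) simp_all

lemma local_rep_T': "local_rep ga (inverse gb) (inverse ga) gb"
  unfolding local_rep_def
proof (intro conjI)
  show "basis ga (inverse gb)" by (rule basisI[of _ ga "inverse gb"]) simp_all
  show "basis (inverse ga) gb" by (rule basisI[of _ "inverse ga" gb]) simp_all
qed (rule braidedI; simp)

lemma local_rep_A: "local_rep (ga powi n * gb * ga powi (- n)) ga (ga powi n * gb * ga powi (- n)) ga"
proof -
  have conj: "(h * (w * inverse h)) powi i = h * (w powi i * inverse h)" for h w :: "gen3 free" and i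
    using power_int_conj[of h w i] by (simp add: mult.assoc)
  have "basis (ga powi n * gb * ga powi (- n)) ga"
    by (rule basisI[of _ gb "gb powi (- n) * ga * gb powi n"])
      (simp_all add: power_int_minus_group mult.assoc)
  then show ?thesis
    unfolding local_rep_def
    by (intro conjI braidedI) (simp_all add: power_int_minus_group conj mult.assoc)
qed

lemma local_rep_B: "local_rep (inverse gb) ga (inverse gb) ga"
proof -
  have "basis (inverse gb) ga" by (rule basisI[of _ gb "inverse ga"]) simp_all
  then show ?thesis unfolding local_rep_def by (intro conjI braidedI) simp_all
qed

lemma local_rep_C: "local_rep (ga * inverse gb * ga) ga (ga * inverse gb * ga) ga"
proof -
  have "basis (ga * inverse gb * ga) ga"
    by (rule basisI[of _ gb "gb * inverse ga * gb"]) (simp_all add: mult.assoc)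
  then show ?thesis unfolding local_rep_def by (intro conjI braidedI) (simp_all add: mult.assoc)
qed

lemma local_rep_D:
  "local_rep (inverse ga * inverse gb * ga) (gb * gb * ga) (inverse ga * inverse gb * ga) (gb * gb * ga)"
proof -
  have "basis (inverse ga * inverse gb * ga) (gb * gb * ga)"
    by (rule basisI[of _ "gb * ga * ga" "gb * inverse ga * inverse gb"])
      (simp_all add: mult.assoc)
  then show ?thesis unfolding local_rep_def by (intro conjI braidedI) (simp_all add: mult.assoc)
qed

lemmas word_simps = power_inverse_group power_int_minus_group power_int_inverse_group mult.assoc
  local_braid_rep_iff free_of_word

text \<open>Within each of the families A, B, C and D all quadruples are sign twists of the first
  one, which alone is checked by computation.\<close>

lemma listed_local_braid_rep: "listed q \<Longrightarrow> local_braid_rep q"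
  unfolding listed_def
proof (elim disjE exE, goal_cases)
  case 1
  then show ?case using local_rep_T by (simp add: word_simps)
next
  case 2
  then show ?case using local_rep_T' by (simp add: word_simps)
next
  case (3 r)
  then show ?case using local_rep_A[of "int r"] by (simp add: word_simps)
next
  case (4 r)
  then show ?case
    using local_rep_twist[OF local_rep_A[of "int r"], where e = 1 and f = 1 and d = "-1"] by (simp add: word_simps)
next
  case (5 r)
  then show ?case
    using local_rep_twist[OF local_rep_A[of "int r"], where e = 1 and f = "-1" and d = 1] by (simp add: word_simps)
next
  case 6
  then show ?case using local_rep_B by (simp add: word_simps)
next
  case 7
  then show ?case using local_rep_twist[OF local_rep_B, where e = 1 and f = 1 and d = "-1"] by (simp add: word_simps)
next
  case 8
  then show ?case using local_rep_C by (simp add: word_simps)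
next
  case 9
  then show ?case using local_rep_twist[OF local_rep_C, where e = 1 and f = 1 and d = "-1"] by (simp add: word_simps)
next
  case 10
  then show ?case using local_rep_twist[OF local_rep_C, where e = 1 and f = "-1" and d = 1] by (simp add: word_simps)
next
  case 11
  then show ?case using local_rep_D by (simp add: word_simps)
next
  case 12
  then show ?case using local_rep_twist[OF local_rep_D, where e = "-1" and f = 1 and d = 1] by (simp add: word_simps)
next
  case 13
  then show ?case using local_rep_twist[OF local_rep_D, where e = 1 and f = 1 and d = "-1"] by (simp add: word_simps)
next
  case 14
  then show ?case using local_rep_twist[OF local_rep_D, where e = "-1" and f = 1 and d = "-1"] by (simp add: word_simps)
qed

lemma up_to_symmetry_local_braid_rep: "up_to_symmetry q \<Longrightarrow> local_braid_rep q"
proof (induction rule: up_to_symmetry.induct)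
  case (base q)
  then show ?case by (rule listed_local_braid_rep)
next
  case (swap q)
  obtain A B C D where "q = (A, B, C, D)" by (cases q)
  then show ?case
    using swap local_rep_swap by (simp add: sym_swap_def local_braid_rep_iff free_of_map_swap_letter)
next
  case (backward q)
  obtain A B C D where "q = (A, B, C, D)" by (cases q)
  then show ?case
    using backward local_rep_backward by (simp add: sym_backward_def local_braid_rep_iff free_of_rev)
next
  case (inverse A B C D)
  have "basis (free_of A) (free_of B)" "basis (free_of C) (free_of D)"
    using inverse.hyps by (simp_all add: is_aut_iff_basis)
  then obtain P Q R S where "ev P (free_of A) (free_of B) = ga" "ev Q (free_of A) (free_of B) = gb"
    "ev R (free_of C) (free_of D) = ga" "ev S (free_of C) (free_of D) = gb"
    unfolding basis_def generating_def by meson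
  then have pairs: "inverse_pair (free_of A) (free_of B) P Q" "inverse_pair (free_of C) (free_of D) R S"
    using \<open>basis (free_of A) (free_of B)\<close> \<open>basis (free_of C) (free_of D)\<close> basis_imp_inverse_pair by blast+
  then show ?case
    using inverse.IH local_rep_inverse sym_inverse_eq[OF pairs] by (simp add: local_braid_rep_iff)
qed

definition up_to_sym :: "gen2 free \<Rightarrow> gen2 free \<Rightarrow> gen2 free \<Rightarrow> gen2 free \<Rightarrow> bool" where
  "up_to_sym A B C D \<longleftrightarrow> up_to_symmetry (word_of A, word_of B, word_of C, word_of D)"

lemma up_to_sym_swap:
  assumes "up_to_sym A B C D"
  shows "up_to_sym (swap_gens D) (swap_gens C) (swap_gens B) (swap_gens A)"
proof -
  have "map swap_letter (word_of W) = word_of (swap_gens W)" for W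
    by (rule free_of_inject_reduced) (simp_all add: free_of_map_swap_letter)
  then show ?thesis
    using up_to_symmetry.swap[OF assms[unfolded up_to_sym_def]] by (simp add: up_to_sym_def sym_swap_def)
qed

lemma up_to_sym_unswap:
  "up_to_sym (swap_gens D) (swap_gens C) (swap_gens B) (swap_gens A) \<Longrightarrow> up_to_sym A B C D"
  using up_to_sym_swap[of "swap_gens D" "swap_gens C" "swap_gens B" "swap_gens A"]
  by (simp only: swap_gens_swap_gens)

lemma up_to_sym_backward:
  assumes "up_to_sym A B C D"
  shows "up_to_sym (backward A) (backward B) (backward C) (backward D)"
proof -
  have "rev (word_of W) = word_of (backward W)" for W
    by (rule free_of_inject_reduced) (simp_all add: free_of_rev)
  then show ?thesis
    using up_to_symmetry.backward[OF assms[unfolded up_to_sym_def]]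
    by (simp add: up_to_sym_def sym_backward_def)
qed

lemma up_to_sym_inverse:
  assumes "up_to_sym A B C D" "inverse_pair A B P Q" "inverse_pair C D R S"
  shows "up_to_sym P Q R S"
proof -
  have "is_aut (pair_end (word_of A) (word_of B))" "is_aut (pair_end (word_of C) (word_of D))"
    using assms(2,3) by (simp_all add: is_aut_iff_basis inverse_pair_basis)
  from up_to_symmetry.inverse[OF assms(1)[unfolded up_to_sym_def] this] show ?thesis
    using sym_inverse_eq[of "word_of A" "word_of B" P Q "word_of C" "word_of D" R S] assms(2,3)
    by (simp add: up_to_sym_def)
qed

lemma reduced_replicate_conj:
  fixes l m :: "bool \<times> 'g"
  assumes "snd l \<noteq> snd m"
  shows "reduced (replicate r l @ [m] @ replicate r (inv_letter l))"
proof -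
  have red: "reduced (replicate r l)" for l :: "bool \<times> 'g"
    by (induction r) (auto simp: reduced_Cons hd_replicate)
  show ?thesis using assms red[of l] red[of "inv_letter l"]
    by (auto simp: reduced_append reduced_Cons hd_replicate last_replicate)
qed

lemma up_to_sym_listed:
  assumes "listed (A, B, C, D)" "free_of A = A'" "free_of B = B'" "free_of C = C'" "free_of D = D'"
  shows "up_to_sym A' B' C' D'"
proof -
  have "reduced A \<and> reduced B \<and> reduced C \<and> reduced D"
    using assms(1) reduced_replicate_conj[of la lb] reduced_replicate_conj[of la lB]
      reduced_replicate_conj[of lA lB]
    unfolding listed_def by (elim disjE exE) simp_all
  then have "(A, B, C, D) = (word_of A', word_of B', word_of C', word_of D')"
    using assms(2-) by auto
  then show ?thesis
    using assms(1) up_to_symmetry.base unfolding up_to_sym_def by metis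
qed

section \<open>Every solution is listed up to symmetry\<close>

lemma listed_A:
  "listed (replicate r la @ [lb] @ replicate r lA, [la], replicate r la @ [lb] @ replicate r lA, [la])"
  "listed (replicate r la @ [lb] @ replicate r lA, [la], replicate r la @ [lB] @ replicate r lA, [lA])"
  "listed (replicate r la @ [lB] @ replicate r lA, [lA], replicate r lA @ [lB] @ replicate r la, [lA])"
proof -
  show "listed (replicate r la @ [lb] @ replicate r lA, [la], replicate r la @ [lb] @ replicate r lA, [la])"
    unfolding listed_def by (rule disjI2[OF disjI2[OF disjI1]], rule exI[of _ r], simp)
  show "listed (replicate r la @ [lb] @ replicate r lA, [la], replicate r la @ [lB] @ replicate r lA, [lA])"
    unfolding listed_def by (rule disjI2[OF disjI2[OF disjI2[OF disjI1]]], rule exI[of _ r], simp)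
  show "listed (replicate r la @ [lB] @ replicate r lA, [lA], replicate r lA @ [lB] @ replicate r la, [lA])"
    unfolding listed_def by (rule disjI2[OF disjI2[OF disjI2[OF disjI2[OF disjI1]]]], rule exI[of _ r], simp)
qed

text \<open>Negative \<open>n\<close> arises by reading backwards, here and for the next two sign
  patterns.\<close>

lemma up_to_sym_A1: "up_to_sym (ga powi n * gb * ga powi (- n)) ga (ga powi n * gb * ga powi (- n)) ga"
proof -
  have nonneg: "up_to_sym (ga powi int r * gb * ga powi (- int r)) ga (ga powi int r * gb * ga powi (- int r)) ga" for r
    by (rule up_to_sym_listed[of "replicate r la @ [lb] @ replicate r lA" "[la]"
          "replicate r la @ [lb] @ replicate r lA" "[la]"])
      (rule listed_A, simp_all add: word_simps)
  show ?thesis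
  proof (cases n rule: int_cases2)
    case (nonpos r)
    then show ?thesis
      using up_to_sym_backward[OF nonneg[of r]] by (simp add: backward_def word_simps)
  qed (use nonneg in simp)
qed

lemma up_to_sym_A2:
  "up_to_sym (ga powi n * gb * ga powi (- n)) ga (ga powi n * inverse gb * ga powi (- n)) (inverse ga)"
proof -
  have nonneg: "up_to_sym (ga powi int r * gb * ga powi (- int r)) ga
      (ga powi int r * inverse gb * ga powi (- int r)) (inverse ga)" for r
    by (rule up_to_sym_listed[of "replicate r la @ [lb] @ replicate r lA" "[la]"
          "replicate r la @ [lB] @ replicate r lA" "[lA]"])
      (rule listed_A, simp_all add: word_simps)
  show ?thesis
  proof (cases n rule: int_cases2)
    case (nonpos r)
    then show ?thesis
      using up_to_sym_backward[OF nonneg[of r]] by (simp add: backward_def word_simps)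
  qed (use nonneg in simp)
qed

lemma up_to_sym_A3:
  "up_to_sym (ga powi n * inverse gb * ga powi (- n)) (inverse ga)
     (ga powi (- n) * inverse gb * ga powi n) (inverse ga)"
proof -
  have nonneg: "up_to_sym (ga powi int r * inverse gb * ga powi (- int r)) (inverse ga)
      (ga powi (- int r) * inverse gb * ga powi int r) (inverse ga)" for r
    by (rule up_to_sym_listed[of "replicate r la @ [lB] @ replicate r lA" "[lA]"
          "replicate r lA @ [lB] @ replicate r la" "[lA]"])
      (rule listed_A, simp_all add: word_simps)
  show ?thesis
  proof (cases n rule: int_cases2)
    case (nonpos r)
    then show ?thesis
      using up_to_sym_backward[OF nonneg[of r]] by (simp add: backward_def word_simps)
  qed (use nonneg in simp)
qed

text \<open>This sign pattern is not listed; it comes from the second one by inverse followed by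
  swap.\<close>

lemma up_to_sym_A4:
  "up_to_sym (ga powi n * inverse gb * ga powi (- n)) (inverse ga) (ga powi (- n) * gb * ga powi n) ga"
proof -
  have "up_to_sym gb (gb powi (- n) * ga * gb powi n)
      (inverse gb) (gb powi n * inverse ga * gb powi (- n))"
    by (rule up_to_sym_inverse[OF up_to_sym_A2[of n]]) (simp_all add: inverse_pair_def word_simps)
  from up_to_sym_swap[OF this] show ?thesis by (simp add: word_simps)
qed

lemma up_to_sym_B:
  "up_to_sym (inverse gb) ga (inverse gb) ga" "up_to_sym (inverse gb) ga gb (inverse ga)"
  "up_to_sym gb (inverse ga) gb (inverse ga)" "up_to_sym gb (inverse ga) (inverse gb) ga"
proof -
  show 1: "up_to_sym (inverse gb) ga (inverse gb) ga"
    by (rule up_to_sym_listed[of "[lB]" "[la]" "[lB]" "[la]"]) (simp_all add: listed_def word_simps)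
  show 2: "up_to_sym (inverse gb) ga gb (inverse ga)"
    by (rule up_to_sym_listed[of "[lB]" "[la]" "[lb]" "[lA]"]) (simp_all add: listed_def word_simps)
  show "up_to_sym gb (inverse ga) gb (inverse ga)" using up_to_sym_swap[OF 1] by simp
  show "up_to_sym gb (inverse ga) (inverse gb) ga"
    by (rule up_to_sym_inverse[OF 2]) (simp_all add: inverse_pair_def)
qed

text \<open>After a swap the listed quadruples have the shape in which the equations are solved. The
  last sign pattern is the inverse of the second listed quadruple.\<close>

lemma up_to_sym_C:
  "up_to_sym gb (gb * inverse ga * gb) gb (gb * inverse ga * gb)"
  "up_to_sym (inverse gb) (gb * ga * gb) gb (gb * inverse ga * gb)"
  "up_to_sym (inverse gb) (gb * ga * gb) (inverse gb) (gb * ga * gb)"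
  "up_to_sym gb (gb * inverse ga * gb) (inverse gb) (gb * ga * gb)"
proof -
  have 1: "up_to_sym (ga * inverse gb * ga) ga (ga * inverse gb * ga) ga"
    by (rule up_to_sym_listed[of "[la, lB, la]" "[la]" "[la, lB, la]" "[la]"])
      (simp_all add: listed_def word_simps)
  have 2: "up_to_sym (ga * inverse gb * ga) ga (ga * gb * ga) (inverse ga)"
    by (rule up_to_sym_listed[of "[la, lB, la]" "[la]" "[la, lb, la]" "[lA]"])
      (simp_all add: listed_def word_simps)
  have 3: "up_to_sym (ga * gb * ga) (inverse ga) (ga * gb * ga) (inverse ga)"
    by (rule up_to_sym_listed[of "[la, lb, la]" "[lA]" "[la, lb, la]" "[lA]"])
      (simp_all add: listed_def word_simps)
  show "up_to_sym gb (gb * inverse ga * gb) gb (gb * inverse ga * gb)"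
    "up_to_sym (inverse gb) (gb * ga * gb) gb (gb * inverse ga * gb)"
    "up_to_sym (inverse gb) (gb * ga * gb) (inverse gb) (gb * ga * gb)"
    using up_to_sym_swap[OF 1] up_to_sym_swap[OF 2] up_to_sym_swap[OF 3] by simp_all
  show "up_to_sym gb (gb * inverse ga * gb) (inverse gb) (gb * ga * gb)"
    by (rule up_to_sym_inverse[OF 2]) (simp_all add: inverse_pair_def word_simps)
qed

lemma up_to_sym_D:
  "up_to_sym (inverse ga * inverse gb * ga) (gb * gb * ga) (inverse ga * inverse gb * ga) (gb * gb * ga)"
  "up_to_sym (ga * gb * inverse ga) (gb * gb * inverse ga) (inverse ga * inverse gb * ga) (gb * gb * ga)"
  "up_to_sym (inverse ga * inverse gb * ga) (gb * gb * ga) (inverse ga * gb * ga) (inverse ga * gb * gb)"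
  "up_to_sym (ga * gb * inverse ga) (gb * gb * inverse ga) (inverse ga * gb * ga) (inverse ga * gb * gb)"
  by (rule up_to_sym_listed[of "[lA, lB, la]" "[lb, lb, la]" "[lA, lB, la]" "[lb, lb, la]"]
      up_to_sym_listed[of "[la, lb, lA]" "[lb, lb, lA]" "[lA, lB, la]" "[lb, lb, la]"]
      up_to_sym_listed[of "[lA, lB, la]" "[lb, lb, la]" "[lA, lb, la]" "[lA, lb, lb]"]
      up_to_sym_listed[of "[la, lb, lA]" "[lb, lb, lA]" "[lA, lb, la]" "[lA, lb, lb]"],
      simp_all add: listed_def word_simps)+

lemma untwist:
  assumes "e = 1 \<or> e = -1"
  shows "ev (ev A (ga powi e) gb powi e) (ga powi e) gb powi e = A"
    "ev (ev A (ga powi e) gb) (ga powi e) gb = A"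
    "ev (ev A ga (gb powi e)) ga (gb powi e) = A"
    "ev (ev A ga (gb powi e) powi e) ga (gb powi e) powi e = A"
  by (simp_all add: ev_ev power_int_sign[OF assms])

text \<open>Two signs suffice: if \<open>e\<close> and \<open>d\<close> are the exponents of b in
  \<open>A\<close> and \<open>C\<close>, both exponents become 1.\<close>

lemma local_rep_sign_twist:
  assumes "local_rep A B C D" "e = 1 \<or> e = -1" "d = 1 \<or> d = -1"
  shows "local_rep (ev A (ga powi e) gb powi e) (ev B (ga powi e) gb)
    (ev C ga (gb powi d)) (ev D ga (gb powi d) powi d)"
  using local_rep_twist[OF assms(1,2) _ assms(3), of 1] by simp

lemma antidiagonal_listed:
  assumes rep: "local_rep A B C D"
    and ex: "ea A = 0" "eb B = 0" "ea C = 0" "eb D = 0" "eb A * ea B = eb C * ea D" "\<bar>eb A * ea B\<bar> = 1"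
  shows "up_to_sym A B C D"
proof -
  \<comment> \<open>\<open>e\<close> and \<open>d\<close> are the twisting signs. The product of the
    antidiagonal exponents is invariant under twisting, so \<epsilon> is the exponent of a in the
    twisted \<open>B\<close>.\<close>
  define e d \<epsilon> where "e = eb A" and "d = eb C" and "\<epsilon> = eb A * ea B"
  have sign: "y = 1 \<or> y = -1" if "\<bar>y * z\<bar> = 1" for y z :: int
    using that by (auto simp: abs_mult zmult_eq_1_iff)
  have e: "e = 1 \<or> e = -1" and d: "d = 1 \<or> d = -1" and \<epsilon>: "\<epsilon> = 1 \<or> \<epsilon> = -1"
    using ex sign[of "eb A" "ea B"] sign[of "eb C" "ea D"] sign[of \<epsilon> 1]
    by (simp_all add: e_def d_def \<epsilon>_def)
  have B: "ea B = e * \<epsilon>" and D: "ea D = d * \<epsilon>"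
    using e d ex(5) by (auto simp: e_def d_def \<epsilon>_def)
  let ?A = "ev A (ga powi e) gb powi e" and ?B = "ev B (ga powi e) gb"
  let ?C = "ev C ga (gb powi d)" and ?D = "ev D ga (gb powi d) powi d"
  have ee: "e * e = 1" "d * d = 1" "e * \<epsilon> * e = \<epsilon>" "d * (d * \<epsilon>) = \<epsilon>" using e d by auto
  have "\<exists>n. (\<epsilon> = 1 \<or> n = 0) \<and>
    (?A = ga powi n * gb * ga powi (- n) \<and> ?B = ga powi \<epsilon> \<and> ?C = ?A \<and> ?D = ?B \<or>
     ?A = gb \<and> ?B = gb powi n * ga powi \<epsilon> * gb powi (- n) \<and> ?C = ?A \<and> ?D = ?B)"
    by (rule solve_antidiagonal[OF local_rep_sign_twist[OF rep e d] \<epsilon>])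
      (simp_all add: ex(1-4) B D ee e_def[symmetric] d_def[symmetric])
  then obtain n where n: "\<epsilon> = 1 \<or> n = 0"
    and sol: "?A = ga powi n * gb * ga powi (- n) \<and> ?B = ga powi \<epsilon> \<and> ?C = ?A \<and> ?D = ?B \<or>
     ?A = gb \<and> ?B = gb powi n * ga powi \<epsilon> * gb powi (- n) \<and> ?C = ?A \<and> ?D = ?B" by blast
  note un = untwist(1)[OF e, of A] untwist(2)[OF e, of B] untwist(3)[OF d, of C] untwist(4)[OF d, of D]
  have conj: "(h * (w * inverse h)) powi i = h * (w powi i * inverse h)" for h w :: "gen2 free" and i
    using power_int_conj[of h w i] by (simp add: mult.assoc)
  from \<epsilon> show ?thesis
  proof
    assume eps: "\<epsilon> = 1"
    have fam: "up_to_sym (ga powi (i * n) * gb powi i * ga powi (- (i * n))) (ga powi i)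
      (ga powi n * gb powi j * ga powi (- n)) (ga powi j)"
      if "i = 1 \<or> i = -1" "j = 1 \<or> j = -1" for i j
      using that up_to_sym_A1[of n] up_to_sym_A2[of n] up_to_sym_A3[of "- n"] up_to_sym_A4[of "- n"]
      by (auto simp: power_int_minus_group)
    from sol show ?thesis
    proof (elim disjE conjE)
      assume *: "?A = ga powi n * gb * ga powi (- n)" "?B = ga powi \<epsilon>" "?C = ?A" "?D = ?B"
      have "A = ga powi (e * n) * gb powi e * ga powi (- (e * n))" "B = ga powi e"
        "C = ga powi n * gb powi d * ga powi (- n)" "D = ga powi d"
        using un unfolding *(3,4) unfolding *(1,2) eps
        by (simp_all add: power_int_minus_group conj mult.assoc power_int_mult_group)
      then show ?thesis using fam[OF e d] by simp
    next
      assume *: "?A = gb" "?B = gb powi n * ga powi \<epsilon> * gb powi (- n)" "?C = ?A" "?D = ?B"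
      have "A = gb powi e" "B = gb powi n * ga powi e * gb powi (- n)" "C = gb powi d"
        "D = gb powi (d * n) * ga powi d * gb powi (- (d * n))"
        using un unfolding *(3,4) unfolding *(1,2) eps
        by (simp_all add: power_int_minus_group conj mult.assoc power_int_mult_group)
      \<comment> \<open>The second alternative is the swap of the first, with the two signs
        exchanged.\<close>
      then show ?thesis
        using fam[OF d e] by (simp add: up_to_sym_unswap)
    qed
  next
    assume eps: "\<epsilon> = -1"
    then have "n = 0" using n by simp
    then have *: "?A = gb" "?B = inverse ga" "?C = gb" "?D = inverse ga"
      using sol eps by (auto simp: power_int_minus_group)
    have "A = gb powi e" "B = inverse ga powi e" "C = gb powi d" "D = inverse ga powi d"
      using un unfolding * by (simp_all add: power_int_inverse_group)
    then show ?thesis using e d up_to_sym_B by (auto simp: power_int_minus_group)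
  qed
qed

lemma parabolic_listed:
  assumes rep: "local_rep A B C D"
    and ex: "ea A = 0" "eb B = 2" "ea C = 0" "eb D = 2" "eb A * ea B = -1" "eb C * ea D = -1"
  shows "up_to_sym A B C D"
proof -
  define e d where "e = eb A" and "d = eb C"
  have sign: "y = 1 \<and> z = -1 \<or> y = -1 \<and> z = 1" if "y * z = -1" for y z :: int
    using that zmult_eq_1_iff[of y "- z"] by auto
  have e: "e = 1 \<or> e = -1" and d: "d = 1 \<or> d = -1" and B: "ea B = - e" and D: "ea D = - d"
    using sign[OF ex(5)] sign[OF ex(6)] by (auto simp: e_def d_def)
  let ?A = "ev A (ga powi e) gb powi e" and ?B = "ev B (ga powi e) gb"
  let ?C = "ev C ga (gb powi d)" and ?D = "ev D ga (gb powi d) powi d"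
  have ee: "e * e = 1" "d * d = 1" using e d by auto
  have "?A = gb \<and> ?B = gb * inverse ga * gb \<and> ?C = gb \<and> ?D = gb * inverse ga * gb \<or>
    ?A = ga * gb * inverse ga \<and> ?B = gb * gb * inverse ga \<and>
      ?C = inverse ga * gb * ga \<and> ?D = inverse ga * gb * gb \<or>
    ?A = inverse ga * gb * ga \<and> ?B = inverse ga * gb * gb \<and>
      ?C = ga * gb * inverse ga \<and> ?D = gb * gb * inverse ga"
    by (rule solve_parabolic[OF local_rep_sign_twist[OF rep e d]])
      (simp_all add: ex B D ee e_def[symmetric] d_def[symmetric])
  note sol = this
  note un = untwist(1)[OF e, of A] untwist(2)[OF e, of B] untwist(3)[OF d, of C] untwist(4)[OF d, of D]
  from sol show ?thesis
  proof (elim disjE conjE)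
    assume *: "?A = gb" "?B = gb * inverse ga * gb" "?C = gb" "?D = gb * inverse ga * gb"
    show ?thesis using un unfolding * using e d up_to_sym_C
      by (auto simp: power_int_minus_group mult.assoc)
  next
    assume *: "?A = ga * gb * inverse ga" "?B = gb * gb * inverse ga"
      "?C = inverse ga * gb * ga" "?D = inverse ga * gb * gb"
    show ?thesis using un unfolding * using e d up_to_sym_D
      by (auto simp: power_int_minus_group mult.assoc)
  next
    assume *: "?A = inverse ga * gb * ga" "?B = inverse ga * gb * gb"
      "?C = ga * gb * inverse ga" "?D = gb * gb * inverse ga"
    \<comment> \<open>The third solution is the second one read backwards.\<close>
    show ?thesis using un unfolding * using e d up_to_sym_D[THEN up_to_sym_backward]
      by (auto simp: power_int_minus_group mult.assoc backward_def)
  qed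
qed

lemma local_rep_listed:
  assumes rep: "local_rep A B C D"
  shows "up_to_sym A B C D"
proof -
  have T: "up_to_sym ga gb ga gb" "up_to_sym ga (inverse gb) (inverse ga) gb"
    by (rule up_to_sym_listed[of "[la]" "[lb]" "[la]" "[lb]"]
        up_to_sym_listed[of "[la]" "[lB]" "[lA]" "[lb]"], simp_all add: listed_def word_simps)+
  from local_rep_exponents[OF rep] show ?thesis
  proof (elim disjE bexE conjE, goal_cases)
    case (1 e)
    then have e: "e = 1 \<or> e = -1" by simp
    from solve_diagonal[OF rep e 1(2-)] e show ?case
      using T by (auto simp: power_int_minus_group)
  next
    case 2
    then show ?case by (rule antidiagonal_listed[OF rep])
  next
    case 3
    then show ?case by (rule parabolic_listed[OF rep])
  next
    case 4
    \<comment> \<open>The swap leads back to the preceding case.\<close>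
    show ?case
      by (rule up_to_sym_unswap[OF parabolic_listed[OF local_rep_swap[OF rep]]])
        (use 4 in \<open>simp_all add: mult.commute\<close>)
  next
    case 5
    then show ?case using no_sporadic[OF rep] by blast
  qed
qed

theorem theorem2p1:
  fixes A B C D :: "gen2 fword"
  assumes "reduced A" and "reduced B" and "reduced C" and "reduced D"
  shows "local_braid_rep (A, B, C, D) \<longleftrightarrow> up_to_symmetry (A, B, C, D)"
proof
  assume "local_braid_rep (A, B, C, D)"
  then have "up_to_sym (free_of A) (free_of B) (free_of C) (free_of D)"
    by (simp add: local_braid_rep_iff local_rep_listed)
  then show "up_to_symmetry (A, B, C, D)" using assms by (simp add: up_to_sym_def)
qed (rule up_to_symmetry_local_braid_rep)

end
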